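(* Let $(\mathcal W,S)$ be an irreducible Coxeter system with $S$ finite, and let $c\in\mathcal W$ be a Coxeter element. Let $\alpha\in\mathcal P(c)$ and let $\Psi$ be a finite nonempty subset of $\mathcal P(c)$. Then $\mathfrak N(\alpha)\cap\mathfrak M(c)$ and $\mathfrak N(\Psi)\cap\mathfrak M(c)$ are sublattices of the lattice $(\mathfrak M(c),\preceq)$.
   Context: Coxeter setting. $(\mathcal W,S)$ has Coxeter matrix $(m(s,s'))_{s,s'\in S}$. Its Coxeter graph $\Gamma$ has vertex set $\Gamma_0$ with a fixed bijection $\rho:\Gamma_0\to S$; distinct vertices $x,y$ are joined by an edge (exactly one) iff $2<m(\rho(x),\rho(y))\le\infty$; irreducible means that $\Gamma$ is connected. Graph monoid. $\mathfrak M$ is the quotient of the free monoid on $\Gamma_0$ by the congruence generated by $vw\sim wv$ for all distinct $v,w\in\Gamma_0$ not joined by an edge. Its elements are written as words $X=x_l\cdots x_1$ ($x_j\in\Gamma_0$, $l\ge 0$). The letter $\rho$ also denotes the induced monoid homomorphism $\mathfrak M\to\mathcal W$. Partial order on $\mathfrak M$: $Y\preceq X$ iff $X=UY$ for some $U\in\mathfrak M$. Roots. $\mathbb V$ is the real vector space with basis $\{\alpha_s\mid s\in S\}$ and symmetric bilinear form $B(\alpha_s,\alpha_{s'})=-2\cos\frac{\pi}{m(s,s')}$ (with $\frac{\pi}{\infty}=0$). $\mathcal W$ acts on $\mathbb V$ by $s\lambda=\lambda-B(\alpha_s,\lambda)\alpha_s$. The roots are the vectors $w(\alpha_s)$, $w\in\mathcal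 W$, $s\in S$. A root is positive ($>0$), resp. negative ($<0$), if all its coordinates in the basis $\{\alpha_s\}$ are $\ge 0$, resp. $\le 0$. Coxeter element and admissible words. $c=s_n\cdots s_1$, where $s_1,\dots,s_n$ are all the elements of $S$ in some order, and $v_j=\rho^{-1}(s_j)$. The $c$-orientation of $\Gamma$ directs each edge between $v_i$ and $v_j$ with $j>i$ as $v_j\to v_i$ (it depends only on the element $c$). A sink is a vertex at which no arrow starts. A word $X=x_l\cdots x_1$ is $c$-admissible if $x_1$ is a sink for the $c$-orientation and, for $1<j\le l$, $x_j$ is a sink for the orientation obtained from the $c$-orientation by reversing all arrows incident to $x_1$, then all arrows incident to $x_2$, and so on up to $x_{j-1}$. This is well defined on elements of $\mathfrak M$; $\mathfrak M(c)\subset\mathfrak M$ is the set of $c$-admissible elements. It is known that $(\mathfrak M(c),\preceq)$ is a lattice. Negation. $X\in\mathfrak M$ negates a root $\alpha>0$ if $\rho(X)\alpha<0$, and negates a finite set $\Psi$ of positive roots if it negates every element of $\Psi$; $\mathfrak N(\alpha)$ (resp. $\mathfrak N(\Psi)$) is the set of all elements of $\mathfrak M$ negating $\alpha$ (resp. $\Psi$). A root $\alpha>0$ is $c$-preprojective if some $X\in\mathfrak M(c)$ negates $\alpha$; $\mathcal P(c)$ is the set of $c$-preprojective roots. *)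

theory Defs
  imports Complex_Main "HOL-Library.Extended_Nat" "HOL-Algebra.Generated_Groups"
begin

text \<open>Words are lists written in the usual left-to-right order: the word $x_l \cdots x_1$ is the list
  \<open>[x\<^sub>l, \<dots>, x\<^sub>1]\<close>.\<close>

section \<open>Monoids given by generators and relations\<close>

inductive word_congr :: "'a set \<Rightarrow> ('a list \<Rightarrow> 'a list \<Rightarrow> bool) \<Rightarrow> 'a list \<Rightarrow> 'a list \<Rightarrow> bool"
  for A R where
    base: "R u v \<Longrightarrow> u \<in> lists A \<Longrightarrow> v \<in> lists A \<Longrightarrow> word_congr A R u v"
  | refl: "u \<in> lists A \<Longrightarrow> word_congr A R u u"
  | sym: "word_congr A R u v \<Longrightarrow> word_congr A R v u"
  | trans: "word_congr A R u v \<Longrightarrow> word_congr A R v w \<Longrightarrow> word_congr A R u w"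
  | append: "word_congr A R u v \<Longrightarrow> word_congr A R u' v' \<Longrightarrow> word_congr A R (u @ u') (v @ v')"

definition presented_monoid :: "'a set \<Rightarrow> ('a list \<Rightarrow> 'a list \<Rightarrow> bool) \<Rightarrow> 'a list set monoid" where
  "presented_monoid A R =
    \<lparr> carrier = lists A // {(u, v). word_congr A R u v},
      monoid.mult = (\<lambda>X Y. {w. \<exists>u\<in>X. \<exists>v\<in>Y. word_congr A R (u @ v) w}),
      one = {w. word_congr A R [] w} \<rparr>"

definition word_prod :: "('a, 'b) monoid_scheme \<Rightarrow> 'a list \<Rightarrow> 'a" where
  "word_prod G xs = foldr (\<lambda>x y. x \<otimes>\<^bsub>G\<^esub> y) xs \<one>\<^bsub>G\<^esub>"

section \<open>Coxeter systems\<close>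

record ('w, 'v) coxeter_data =
  cgroup :: "'w monoid"
  cgens :: "'w set"
  cmatrix :: "'w \<Rightarrow> 'w \<Rightarrow> enat"
  cverts :: "'v set"
  clabel :: "'v \<Rightarrow> 'w"

inductive coxeter_relator :: "('w, 'v) coxeter_data \<Rightarrow> 'w list \<Rightarrow> 'w list \<Rightarrow> bool" for D where
  "s \<in> cgens D \<Longrightarrow> t \<in> cgens D \<Longrightarrow> cmatrix D s t = enat k \<Longrightarrow>
     coxeter_relator D (concat (replicate k [s, t])) []"

text \<open>The last conjunct says that the group is presented by the generators and the relations
  $(st)^{m(s,t)} = 1$. The case $s = t$ gives $s^2 = 1$, so inverses of generators are not needed
  and the monoid presentation is the same as the group presentation.\<close>

definition coxeter_system :: "('w, 'v) coxeter_data \<Rightarrow> bool" where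
  "coxeter_system D \<longleftrightarrow>
     group (cgroup D) \<and>
     cgens D \<subseteq> carrier (cgroup D) \<and>
     generate (cgroup D) (cgens D) = carrier (cgroup D) \<and>
     bij_betw (clabel D) (cverts D) (cgens D) \<and>
     (\<forall>s\<in>cgens D. cmatrix D s s = 1) \<and>
     (\<forall>s\<in>cgens D. \<forall>t\<in>cgens D. cmatrix D s t = cmatrix D t s \<and> (s \<noteq> t \<longrightarrow> 2 \<le> cmatrix D s t)) \<and>
     (\<forall>u\<in>lists (cgens D). \<forall>v\<in>lists (cgens D).
        word_prod (cgroup D) u = word_prod (cgroup D) v \<longleftrightarrow>
        word_congr (cgens D) (coxeter_relator D) u v)"

definition coxeter_edge :: "('w, 'v) coxeter_data \<Rightarrow> 'v \<Rightarrow> 'v \<Rightarrow> bool" where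
  "coxeter_edge D x y \<longleftrightarrow> x \<in> cverts D \<and> y \<in> cverts D \<and> x \<noteq> y \<and>
     2 < cmatrix D (clabel D x) (clabel D y)"

definition coxeter_irreducible :: "('w, 'v) coxeter_data \<Rightarrow> bool" where
  "coxeter_irreducible D \<longleftrightarrow>
     (\<forall>x\<in>cverts D. \<forall>y\<in>cverts D. (x, y) \<in> {(a, b). coxeter_edge D a b}\<^sup>*)"

section \<open>The graph monoid\<close>

inductive graph_relator :: "('w, 'v) coxeter_data \<Rightarrow> 'v list \<Rightarrow> 'v list \<Rightarrow> bool" for D where
  "v \<in> cverts D \<Longrightarrow> w \<in> cverts D \<Longrightarrow> v \<noteq> w \<Longrightarrow> \<not> coxeter_edge D v w \<Longrightarrow>
     graph_relator D [v, w] [w, v]"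

definition graph_monoid :: "('w, 'v) coxeter_data \<Rightarrow> 'v list set monoid" where
  "graph_monoid D = presented_monoid (cverts D) (graph_relator D)"

text \<open>The homomorphism induced by the labelling; all words in a class have the same product.\<close>

definition graph_monoid_hom :: "('w, 'v) coxeter_data \<Rightarrow> 'v list set \<Rightarrow> 'w" where
  "graph_monoid_hom D X = the_elem ((\<lambda>xs. word_prod (cgroup D) (map (clabel D) xs)) ` X)"

definition graph_monoid_le :: "('w, 'v) coxeter_data \<Rightarrow> 'v list set \<Rightarrow> 'v list set \<Rightarrow> bool" where
  "graph_monoid_le D Y X \<longleftrightarrow>
     (\<exists>U\<in>carrier (graph_monoid D). X = U \<otimes>\<^bsub>graph_monoid D\<^esub> Y)"

section \<open>Roots\<close>

text \<open>A vector is its function of coordinates in the basis $(\alpha_s)_{s \in S}$, for finite $S$.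
  Every vector used below vanishes outside $S$.\<close>

definition simple_root :: "'w \<Rightarrow> 'w \<Rightarrow> real" where
  "simple_root s = (\<lambda>t. if t = s then 1 else 0)"

definition coxeter_angle :: "enat \<Rightarrow> real" where
  "coxeter_angle m = (case m of enat k \<Rightarrow> pi / real k | \<infinity> \<Rightarrow> 0)"

definition coxeter_form :: "('w, 'v) coxeter_data \<Rightarrow> ('w \<Rightarrow> real) \<Rightarrow> ('w \<Rightarrow> real) \<Rightarrow> real" where
  "coxeter_form D f g =
     (\<Sum>s\<in>cgens D. \<Sum>t\<in>cgens D. f s * g t * (- 2 * cos (coxeter_angle (cmatrix D s t))))"

definition reflection :: "('w, 'v) coxeter_data \<Rightarrow> 'w \<Rightarrow> ('w \<Rightarrow> real) \<Rightarrow> 'w \<Rightarrow> real" where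
  "reflection D s f = (\<lambda>t. f t - coxeter_form D (simple_root s) f * simple_root s t)"

text \<open>The action of a group element is computed from any word in the generators representing it;
  the result does not depend on the word.\<close>

definition coxeter_action :: "('w, 'v) coxeter_data \<Rightarrow> 'w \<Rightarrow> ('w \<Rightarrow> real) \<Rightarrow> 'w \<Rightarrow> real" where
  "coxeter_action D w f =
     the_elem ((\<lambda>ss. foldr (reflection D) ss f) ` {ss \<in> lists (cgens D). word_prod (cgroup D) ss = w})"

definition roots :: "('w, 'v) coxeter_data \<Rightarrow> ('w \<Rightarrow> real) set" where
  "roots D = {coxeter_action D w (simple_root s) | w s. w \<in> carrier (cgroup D) \<and> s \<in> cgens D}"

definition positive_roots :: "('w, 'v) coxeter_data \<Rightarrow> ('w \<Rightarrow> real) set" where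
  "positive_roots D = {f \<in> roots D. \<forall>s\<in>cgens D. 0 \<le> f s}"

definition negative_roots :: "('w, 'v) coxeter_data \<Rightarrow> ('w \<Rightarrow> real) set" where
  "negative_roots D = {f \<in> roots D. \<forall>s\<in>cgens D. f s \<le> 0}"

section \<open>Coxeter elements and admissible words\<close>

definition coxeter_word :: "('w, 'v) coxeter_data \<Rightarrow> 'w \<Rightarrow> 'w list \<Rightarrow> bool" where
  "coxeter_word D c ss \<longleftrightarrow> distinct ss \<and> set ss = cgens D \<and> word_prod (cgroup D) ss = c"

definition coxeter_element :: "('w, 'v) coxeter_data \<Rightarrow> 'w \<Rightarrow> bool" where
  "coxeter_element D c \<longleftrightarrow> (\<exists>ss. coxeter_word D c ss)"

text \<open>An orientation is a set of arrows. For the word $s_n \cdots s_1$, i.e. the list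
  \<open>[s\<^sub>n, \<dots>, s\<^sub>1]\<close>, an edge is directed from the vertex whose label is further to the left (larger
  index) to the one whose label is further to the right (smaller index).\<close>

definition word_orientation :: "('w, 'v) coxeter_data \<Rightarrow> 'w list \<Rightarrow> ('v \<times> 'v) set" where
  "word_orientation D ss = {(v, w). coxeter_edge D v w \<and>
     (\<exists>i j. i < j \<and> j < length ss \<and> ss ! i = clabel D v \<and> ss ! j = clabel D w)}"

text \<open>The orientation depends only on \<open>c\<close>, not on the word chosen to express it.\<close>

definition c_orientation :: "('w, 'v) coxeter_data \<Rightarrow> 'w \<Rightarrow> ('v \<times> 'v) set" where
  "c_orientation D c = word_orientation D (SOME ss. coxeter_word D c ss)"

definition is_sink :: "('w, 'v) coxeter_data \<Rightarrow> ('v \<times> 'v) set \<Rightarrow> 'v \<Rightarrow> bool" where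
  "is_sink D Q x \<longleftrightarrow> x \<in> cverts D \<and> (\<forall>y. (x, y) \<notin> Q)"

definition reverse_at :: "'v \<Rightarrow> ('v \<times> 'v) set \<Rightarrow> ('v \<times> 'v) set" where
  "reverse_at x Q = {(a, b). if a = x \<or> b = x then (b, a) \<in> Q else (a, b) \<in> Q}"

text \<open>Since the rightmost letter $x_1$ comes first, \<open>foldr reverse_at [x\<^sub>j, \<dots>, x\<^sub>1]\<close> reverses at
  $x_1$, then at $x_2$, and so on up to $x_j$.\<close>

fun admissible_word :: "('w, 'v) coxeter_data \<Rightarrow> 'w \<Rightarrow> 'v list \<Rightarrow> bool" where
  "admissible_word D c [] \<longleftrightarrow> True"
| "admissible_word D c (x # xs) \<longleftrightarrow>
     admissible_word D c xs \<and> is_sink D (foldr reverse_at xs (c_orientation D c)) x"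

definition admissible :: "('w, 'v) coxeter_data \<Rightarrow> 'w \<Rightarrow> 'v list set set" where
  "admissible D c = {X \<in> carrier (graph_monoid D). \<exists>xs\<in>X. admissible_word D c xs}"

definition admissible_order :: "('w, 'v) coxeter_data \<Rightarrow> 'w \<Rightarrow> 'v list set gorder" where
  "admissible_order D c =
     \<lparr> carrier = admissible D c, eq = (=), le = graph_monoid_le D \<rparr>"

section \<open>Negation, preprojective roots, sublattices\<close>

definition negators :: "('w, 'v) coxeter_data \<Rightarrow> ('w \<Rightarrow> real) \<Rightarrow> 'v list set set" where
  "negators D a = {X \<in> carrier (graph_monoid D).
     a \<in> positive_roots D \<and> coxeter_action D (graph_monoid_hom D X) a \<in> negative_roots D}"

definition set_negators :: "('w, 'v) coxeter_data \<Rightarrow> ('w \<Rightarrow> real) set \<Rightarrow> 'v list set set" where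
  "set_negators D \<Psi> = {X \<in> carrier (graph_monoid D). \<forall>a\<in>\<Psi>. X \<in> negators D a}"

definition preprojective_roots :: "('w, 'v) coxeter_data \<Rightarrow> 'w \<Rightarrow> ('w \<Rightarrow> real) set" where
  "preprojective_roots D c = {a \<in> positive_roots D. \<exists>X\<in>admissible D c. X \<in> negators D a}"

text \<open>Sublattices are nonempty. The joins and meets are those of \<open>L\<close>.\<close>

definition sublattice :: "('a, 'b) gorder_scheme \<Rightarrow> 'a set \<Rightarrow> bool" where
  "sublattice L A \<longleftrightarrow> lattice L \<and> A \<noteq> {} \<and> A \<subseteq> carrier L \<and>
     (\<forall>x\<in>A. \<forall>y\<in>A. x \<squnion>\<^bsub>L\<^esub> y \<in> A \<and> x \<sqinter>\<^bsub>L\<^esub> y \<in> A)"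

end

theory Submission
  imports Defs
begin

text \<open>An admissible element is determined by the multiplicities of its letters: along an arrow
  $x \to y$ of the $c$-orientation the occurrences alternate beginning with $y$, and joins and meets
  are the pointwise maxima and minima of the multiplicities. If $X \preceq Y$ and the letter $x$ has
  the same multiplicity in both, then $Y = UX$ with no $x$ in $U$, so $\rho(X)\lambda$ and
  $\rho(Y)\lambda$ have the same coordinate at $x$. Hence each coordinate of $\rho(X \vee Y)\alpha$ and
  of $\rho(X \wedge Y)\alpha$ is a coordinate of $\rho(X)\alpha$ or of $\rho(Y)\alpha$, and
  negation passes to joins and meets.

  It remains to negate a finite set of preprojective roots simultaneously. If all admissible words
  are reduced, negation is monotone and a join does it. Otherwise some reduced admissible word
  $X$ has a sink $x$ with $\rho(X)^{-1}\alpha_x < 0$. The Euler form of the orientation is invariant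
  under reflection at sinks; it shows that $\rho(X)^{-1}$ then makes every positive root with $x$ in its
  support negative. As $\Gamma$ is connected, $X$ has a maximal reduced extension not using $x$
  again, all sinks are blocked there, and the Euler form shows that it negates all positive roots.\<close>

section \<open>Words\<close>

lemma word_congr_lists:
  assumes "word_congr A R u v"
  shows "u \<in> lists A" "v \<in> lists A"
  using assms by (induction rule: word_congr.induct) auto

lemma word_prod_Nil [simp]: "word_prod G [] = \<one>\<^bsub>G\<^esub>"
  by (simp add: word_prod_def)

lemma word_prod_Cons [simp]: "word_prod G (x # xs) = x \<otimes>\<^bsub>G\<^esub> word_prod G xs"
  by (simp add: word_prod_def)

lemma (in monoid) word_prod_closed:
  "set xs \<subseteq> carrier G \<Longrightarrow> word_prod G xs \<in> carrier G"
  by (induction xs) auto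

lemma (in monoid) word_prod_append:
  "set xs \<subseteq> carrier G \<Longrightarrow> set ys \<subseteq> carrier G \<Longrightarrow>
    word_prod G (xs @ ys) = word_prod G xs \<otimes> word_prod G ys"
  by (induction xs) (auto simp: m_assoc word_prod_closed)

section \<open>Alternating words in two letters and their Chebyshev coefficients\<close>

fun alt_word :: "'a \<Rightarrow> 'a \<Rightarrow> nat \<Rightarrow> 'a list" where
  "alt_word s t 0 = []"
| "alt_word s t (Suc n) = alt_word t s n @ [t]"

lemma length_alt_word [simp]: "length (alt_word s t n) = n"
  by (induction n arbitrary: s t) auto

lemma set_alt_word: "set (alt_word s t n) \<subseteq> {s, t}"
  by (induction n arbitrary: s t) auto

text \<open>The recursion builds the word from its right end, the letter that acts first; the letter
  at the left end therefore depends on the parity.\<close>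

lemma alt_word_Suc_left: "alt_word s t (Suc n) = (if even n then t else s) # alt_word s t n"
  by (induction n arbitrary: s t) auto

lemma alt_word_add:
  "alt_word s t (n + k) = (if even k then alt_word s t n else alt_word t s n) @ alt_word s t k"
  by (induction k arbitrary: s t) auto

lemma rev_alt_word: "rev (alt_word s t n) = (if even n then alt_word t s n else alt_word s t n)"
proof (induction n arbitrary: s t)
  case (Suc n)
  then show ?case
    using alt_word_Suc_left[of s t n] alt_word_Suc_left[of t s n] by auto
qed auto

lemma concat_replicate_alt_word: "concat (replicate n [s, t]) = alt_word s t (2 * n)"
proof (induction n)
  case (Suc n)
  have "concat (replicate (Suc n) [s, t]) = [s, t] @ alt_word s t (2 * n)"
    using Suc by simp
  also have "\<dots> = alt_word s t (Suc (Suc (2 * n)))"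
    by (simp only: alt_word_Suc_left) simp
  finally show ?case by simp
qed auto

text \<open>Chebyshev polynomials of the second kind, with index \<open>n - 1\<close> and argument
  \<open>- b / 2\<close>. They are the coordinates of a simple root moved by two alternating
  reflections.\<close>

fun cheb :: "real \<Rightarrow> nat \<Rightarrow> real" where
  "cheb b 0 = 0"
| "cheb b (Suc 0) = 1"
| "cheb b (Suc (Suc n)) = - b * cheb b (Suc n) - cheb b n"

lemma cheb_sin: "sin \<phi> * cheb (- 2 * cos \<phi>) n = sin (real n * \<phi>)"
proof (induction "- 2 * cos \<phi>" n rule: cheb.induct)
  case (3 n)
  have "sin ((real n + 2) * \<phi>) + sin (real n * \<phi>) = 2 * cos \<phi> * sin ((real n + 1) * \<phi>)"
    using sin_add[of "(real n + 1) * \<phi>" \<phi>] sin_diff[of "(real n + 1) * \<phi>" \<phi>]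
    by (simp add: algebra_simps)
  with 3 show ?case by (simp add: algebra_simps)
qed auto

text \<open>The limiting case of angle 0, needed for pairs of generators with infinite
  label.\<close>

lemma cheb_minus_2: "cheb (- 2) n = real n"
  by (induction "- 2 :: real" n rule: cheb.induct) (auto simp: algebra_simps)

section \<open>The reflection representation\<close>

locale coxeter =
  fixes D :: "('w, 'v) coxeter_data"
  assumes sys: "coxeter_system D" and finite_cgens: "finite (cgens D)"
begin

abbreviation G where "G \<equiv> cgroup D"
abbreviation S where "S \<equiv> cgens D"
abbreviation wprod where "wprod \<equiv> word_prod G"
abbreviation B where "B \<equiv> coxeter_form D"
abbreviation e :: "'w \<Rightarrow> 'w \<Rightarrow> real" where "e \<equiv> simple_root"
abbreviation refl where "refl \<equiv> reflection D"
abbreviation act where "act \<equiv> foldr refl"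

definition b :: "'w \<Rightarrow> 'w \<Rightarrow> real" where
  "b s t = - 2 * cos (coxeter_angle (cmatrix D s t))"

text \<open>Linearity of the form, of the reflections and of the action is stated through
  \<open>comb\<close>, so that rewriting can push these maps through a sum.\<close>

definition comb :: "real \<Rightarrow> ('w \<Rightarrow> real) \<Rightarrow> real \<Rightarrow> ('w \<Rightarrow> real) \<Rightarrow> 'w \<Rightarrow> real" where
  "comb p f q g = (\<lambda>t. p * f t + q * g t)"

sublocale group G
  using sys by (simp add: coxeter_system_def)

section \<open>Words in the generators as group elements\<close>

lemma S_carrier: "S \<subseteq> carrier G"
  and generate_S: "generate G S = carrier G"
  and bij_clabel: "bij_betw (clabel D) (cverts D) S"
  and cmatrix_refl: "s \<in> S \<Longrightarrow> cmatrix D s s = 1"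
  and cmatrix_sym: "s \<in> S \<Longrightarrow> t \<in> S \<Longrightarrow> cmatrix D s t = cmatrix D t s"
  and cmatrix_ge_2: "s \<in> S \<Longrightarrow> t \<in> S \<Longrightarrow> s \<noteq> t \<Longrightarrow> 2 \<le> cmatrix D s t"
  and wprod_eq_iff: "u \<in> lists S \<Longrightarrow> v \<in> lists S \<Longrightarrow>
    wprod u = wprod v \<longleftrightarrow> word_congr S (coxeter_relator D) u v"
  using sys unfolding coxeter_system_def by blast+

lemma wprod_append:
  "u \<in> lists S \<Longrightarrow> v \<in> lists S \<Longrightarrow> wprod (u @ v) = wprod u \<otimes>\<^bsub>G\<^esub> wprod v"
  using S_carrier by (intro word_prod_append) auto

lemma wprod_closed: "u \<in> lists S \<Longrightarrow> wprod u \<in> carrier G"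
  using S_carrier by (intro word_prod_closed) auto

lemma wprod_cong_append:
  assumes "wprod u = wprod u'" "wprod v = wprod v'"
    "u \<in> lists S" "u' \<in> lists S" "v \<in> lists S" "v' \<in> lists S"
  shows "wprod (u @ v) = wprod (u' @ v')"
  using assms by (simp add: wprod_append)

lemma wprod_relator:
  assumes "s \<in> S" "t \<in> S" "cmatrix D s t = enat k"
  shows "wprod (concat (replicate k [s, t])) = \<one>\<^bsub>G\<^esub>"
proof -
  have "concat (replicate k [s, t]) \<in> lists S"
    using assms by (auto simp: in_lists_conv_set split: if_splits)
  then have "word_congr S (coxeter_relator D) (concat (replicate k [s, t])) []"
    using assms by (intro word_congr.base) (auto intro: coxeter_relator.intros)
  with wprod_eq_iff[of "concat (replicate k [s, t])" "[]"] show ?thesis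
    using \<open>concat (replicate k [s, t]) \<in> lists S\<close> by simp
qed

lemma gen_square: "s \<in> S \<Longrightarrow> s \<otimes>\<^bsub>G\<^esub> s = \<one>\<^bsub>G\<^esub>"
  using wprod_relator[of s s 1] cmatrix_refl[of s] S_carrier by (auto simp: one_enat_def)

lemma wprod_double:
  assumes "u \<in> lists S" "v \<in> lists S" "s \<in> S"
  shows "wprod (u @ s # s # v) = wprod (u @ v)"
proof -
  have "wprod (s # s # v) = (s \<otimes>\<^bsub>G\<^esub> s) \<otimes>\<^bsub>G\<^esub> wprod v"
    using assms S_carrier wprod_closed[of v] by (simp add: m_assoc subset_iff)
  then show ?thesis
    using assms gen_square[of s] wprod_closed[of v] by (simp add: wprod_append)
qed

lemma wprod_rev: "u \<in> lists S \<Longrightarrow> wprod (u @ rev u) = \<one>\<^bsub>G\<^esub>"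
proof (induction u rule: rev_induct)
  case (snoc x xs)
  then have "rev xs \<in> lists S" by (auto simp: in_lists_conv_set)
  with snoc show ?case using wprod_double[of xs "rev xs" x] by simp
qed simp

text \<open>Generators are involutions, so the reversed word represents the inverse.\<close>

lemma wprod_eqI_rev:
  assumes "u \<in> lists S" "v \<in> lists S" "wprod (u @ v) = \<one>\<^bsub>G\<^esub>"
  shows "wprod u = wprod (rev v)"
proof -
  have rv: "rev v \<in> lists S" using assms by (auto simp: in_lists_conv_set)
  have "wprod u \<otimes>\<^bsub>G\<^esub> wprod v = wprod (rev v) \<otimes>\<^bsub>G\<^esub> wprod v"
    using assms wprod_rev[OF rv] rv by (simp add: wprod_append)
  then show ?thesis using assms rv by (simp add: wprod_closed)
qed

lemma alt_word_lists: "s \<in> S \<Longrightarrow> t \<in> S \<Longrightarrow> alt_word s t n \<in> lists S"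
  using set_alt_word[of s t n] by (auto simp: in_lists_conv_set)

text \<open>The relator is an alternating word of length \<open>2 * m\<close>; bringing its right
  half to the other side inverts that half, that is, reverses it.\<close>

lemma wprod_braid:
  assumes st: "s \<in> S" "t \<in> S" and m: "cmatrix D s t = enat m"
  shows "wprod (alt_word s t m) = wprod (alt_word t s m)"
proof -
  have one: "wprod (alt_word s t (m + m)) = \<one>\<^bsub>G\<^esub>"
    using wprod_relator[OF st m] by (simp add: concat_replicate_alt_word mult_2)
  show ?thesis
  proof (cases "even m")
    case True
    then have "wprod (alt_word s t m @ alt_word s t m) = \<one>\<^bsub>G\<^esub>"
      using one by (simp add: alt_word_add)
    from wprod_eqI_rev[OF _ _ this] True show ?thesis
      using st by (simp add: alt_word_lists rev_alt_word)
  next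
    case False
    then have "wprod (alt_word t s m @ alt_word s t m) = \<one>\<^bsub>G\<^esub>"
      using one by (simp add: alt_word_add)
    from wprod_eqI_rev[OF _ _ this] False show ?thesis
      using st by (simp add: alt_word_lists rev_alt_word)
  qed
qed

lemma wprod_surj:
  assumes "w \<in> carrier G"
  obtains u where "u \<in> lists S" "wprod u = w"
proof -
  have "w \<in> generate G S" using assms generate_S by simp
  then have "\<exists>u\<in>lists S. wprod u = w"
  proof (induction rule: generate.induct)
    case one
    then show ?case by (intro bexI[of _ "[]"]) auto
  next
    case (incl h)
    then show ?case using S_carrier by (intro bexI[of _ "[h]"]) auto
  next
    case (inv h)
    then have "inv\<^bsub>G\<^esub> h = h" using S_carrier gen_square[of h] by (intro inv_equality) auto
    then show ?case using inv S_carrier by (intro bexI[of _ "[h]"]) auto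
  next
    case (eng h1 h2)
    then obtain u v where "u \<in> lists S" "wprod u = h1" "v \<in> lists S" "wprod v = h2" by blast
    then show ?case by (intro bexI[of _ "u @ v"]) (auto simp: wprod_append)
  qed
  then show ?thesis using that by blast
qed

section \<open>The form, the reflections and rank two computations\<close>

lemma e_simps [simp]: "e s s = 1" "s \<noteq> t \<Longrightarrow> e s t = 0"
  by (auto simp: simple_root_def)

lemma b_self [simp]: "s \<in> S \<Longrightarrow> b s s = 2"
  by (simp add: b_def cmatrix_refl coxeter_angle_def one_enat_def)

lemma b_sym: "s \<in> S \<Longrightarrow> t \<in> S \<Longrightarrow> b s t = b t s"
  by (simp add: b_def cmatrix_sym)

lemma form_b: "B f g = (\<Sum>s\<in>S. \<Sum>t\<in>S. f s * g t * b s t)"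
  by (simp add: coxeter_form_def b_def)

lemma form_simple_left: "s \<in> S \<Longrightarrow> B (e s) f = (\<Sum>t\<in>S. f t * b s t)"
proof -
  assume s: "s \<in> S"
  have "B (e s) f = (\<Sum>s'\<in>S. if s' = s then \<Sum>t\<in>S. f t * b s t else 0)"
    unfolding form_b by (intro sum.cong) (auto simp: simple_root_def)
  then show ?thesis using finite_cgens s by simp
qed

lemma form_simple_simple: "s \<in> S \<Longrightarrow> t \<in> S \<Longrightarrow> B (e s) (e t) = b s t"
  using finite_cgens
  by (subst form_simple_left) (auto simp: simple_root_def if_distrib[of "\<lambda>x. x * _"] cong: if_cong)

lemma form_sym: "B f g = B g f"
  unfolding form_b by (subst sum.swap) (auto intro!: sum.cong simp: b_sym)

lemma form_comb_right: "B f (comb p g q h) = p * B f g + q * B f h"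
  by (simp add: form_b comb_def algebra_simps sum.distrib sum_distrib_left)

lemma form_comb_left: "B (comb p g q h) f = p * B g f + q * B h f"
  using form_comb_right[of f p g q h] by (simp add: form_sym)

lemma refl_comb_def: "refl s f = comb 1 f (- B (e s) f) (e s)"
  by (simp add: reflection_def comb_def)

lemma refl_comb: "refl s (comb p f q g) = comb p (refl s f) q (refl s g)"
  by (simp add: reflection_def form_comb_right) (simp add: comb_def algebra_simps)

lemma refl_outside: "t \<noteq> s \<Longrightarrow> refl s f t = f t"
  by (simp add: reflection_def)

lemma form_refl: "s \<in> S \<Longrightarrow> B (refl s f) (refl s g) = B f g"
  by (simp add: refl_comb_def form_comb_left form_comb_right form_simple_simple form_sym[of f "e s"]
      algebra_simps)

lemma refl_refl: "s \<in> S \<Longrightarrow> refl s (refl s f) = f"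
  by (simp add: refl_comb_def form_comb_right form_simple_simple) (simp add: comb_def)

lemma act_comb: "act u (comb p f q g) = comb p (act u f) q (act u g)"
  by (induction u) (auto simp: refl_comb)

lemma form_act: "u \<in> lists S \<Longrightarrow> B (act u f) (act u g) = B f g"
  by (induction u) (auto simp: form_refl)

lemma act_act_rev: "u \<in> lists S \<Longrightarrow> act u (act (rev u) f) = f"
proof (induction u rule: rev_induct)
  case (snoc x xs)
  then show ?case by (simp add: refl_refl)
qed simp

lemma act_rev_act: "u \<in> lists S \<Longrightarrow> act (rev u) (act u f) = f"
  using act_act_rev[of "rev u" f] by (auto simp: in_lists_conv_set simp del: foldr_append)

lemma act_outside: "t \<notin> set u \<Longrightarrow> act u f t = f t"
  by (induction u) (auto simp: refl_outside)

lemma refl_simple: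
  assumes "s \<in> S" "t \<in> S"
  shows "refl t (comb p (e s) q (e t)) = comb p (e s) (- p * b s t - q) (e t)"
  using assms
  by (simp add: refl_comb_def form_comb_right form_simple_simple b_sym[of t s])
    (simp add: comb_def algebra_simps)

lemma comb_commute: "comb p f q g = comb q g p f"
  by (simp add: comb_def add.commute)

text \<open>Each reflection raises the Chebyshev index by one and exchanges the roles of
  \<open>s\<close> and \<open>t\<close>. The starting index \<open>k\<close> is kept general so that
  the induction closes.\<close>

lemma act_alt_word:
  assumes "s \<in> S" "t \<in> S"
  shows "act (alt_word s t n) (comb (cheb (b s t) (Suc k)) (e s) (cheb (b s t) k) (e t)) =
    (if even n then comb (cheb (b s t) (Suc (k + n))) (e s) (cheb (b s t) (k + n)) (e t)
     else comb (cheb (b s t) (k + n)) (e s) (cheb (b s t) (Suc (k + n))) (e t))"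
  using assms
proof (induction n arbitrary: s t k)
  case (Suc n)
  have bs: "b t s = b s t" using Suc.prems by (simp add: b_sym)
  have "refl t (comb (cheb (b s t) (Suc k)) (e s) (cheb (b s t) k) (e t)) =
      comb (cheb (b t s) (Suc (Suc k))) (e t) (cheb (b t s) (Suc k)) (e s)"
    using Suc.prems unfolding bs by (subst comb_commute) (simp add: refl_simple mult.commute)
  then have "act (alt_word s t (Suc n)) (comb (cheb (b s t) (Suc k)) (e s) (cheb (b s t) k) (e t)) =
    (if even n then comb (cheb (b s t) (Suc (Suc k + n))) (e t) (cheb (b s t) (Suc k + n)) (e s)
     else comb (cheb (b s t) (Suc k + n)) (e t) (cheb (b s t) (Suc (Suc k + n))) (e s))"
    using Suc.IH[OF Suc.prems(2,1), of "Suc k"] unfolding bs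
    by (simp only: alt_word.simps foldr_append foldr.simps comp_apply id_apply)
  then show ?case
    by (simp add: comb_commute[of _ "e t"])
qed simp

lemma act_alt_word_simple:
  assumes "s \<in> S" "t \<in> S"
  shows "act (alt_word s t n) (e s) =
    (if even n then comb (cheb (b s t) (Suc n)) (e s) (cheb (b s t) n) (e t)
     else comb (cheb (b s t) n) (e s) (cheb (b s t) (Suc n)) (e t))"
  using act_alt_word[OF assms, of n 0] by (simp add: comb_def)

text \<open>Up to the positive factor \<open>sin \<phi>\<close> the value is the sine of an angle of
  at most pi.\<close>

lemma cheb_b_nonneg:
  assumes "s \<in> S" "t \<in> S" "s \<noteq> t" "enat n \<le> cmatrix D s t"
  shows "0 \<le> cheb (b s t) n"
proof (cases "cmatrix D s t")
  case (enat m)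
  define \<phi> where "\<phi> = pi / real m"
  have m: "2 \<le> m" "n \<le> m"
    using cmatrix_ge_2[of s t] assms enat by (auto simp: numeral_eq_enat)
  have "0 < sin \<phi>" using m by (intro sin_gt_zero) (auto simp: \<phi>_def field_simps)
  moreover have "0 \<le> sin (real n * \<phi>)"
    using m by (intro sin_ge_zero) (auto simp: \<phi>_def field_simps)
  ultimately show ?thesis
    using cheb_sin[of \<phi> n] enat zero_le_mult_iff[of "sin \<phi>" "cheb (b s t) n"]
    by (auto simp: b_def coxeter_angle_def \<phi>_def)
next
  case infinity
  then show ?thesis by (simp add: b_def coxeter_angle_def cheb_minus_2)
qed

text \<open>After \<open>2 * m\<close> reflections the angle has grown by a full turn, so the two
  coefficients return to 1 and 0.\<close>

lemma act_relator_simple: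
  assumes "s \<in> S" "t \<in> S" "s \<noteq> t" "cmatrix D s t = enat m"
  shows "act (alt_word s t (2 * m)) (e s) = e s"
proof -
  define \<phi> where "\<phi> = pi / real m"
  have m: "2 \<le> m"
    using cmatrix_ge_2[of s t] assms by (auto simp: numeral_eq_enat)
  have *: "0 < sin \<phi>" using m by (intro sin_gt_zero) (auto simp: \<phi>_def field_simps)
  have b: "b s t = - 2 * cos \<phi>" using assms by (simp add: b_def coxeter_angle_def \<phi>_def)
  have "real (2 * m) * \<phi> = 2 * pi" using m by (simp add: \<phi>_def)
  moreover have "real (Suc (2 * m)) * \<phi> = \<phi> + 2 * pi" using m by (simp add: \<phi>_def field_simps)
  ultimately have "sin \<phi> * cheb (b s t) (2 * m) = 0" "sin \<phi> * cheb (b s t) (Suc (2 * m)) = sin \<phi>"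
    unfolding b cheb_sin by (simp_all only: sin_two_pi sin_periodic)
  then have "cheb (b s t) (2 * m) = 0" "cheb (b s t) (Suc (2 * m)) = 1"
    using * by simp_all
  then show ?thesis
    using assms act_alt_word_simple[of s t "2 * m"] by (simp add: comb_def)
qed

text \<open>The plane spanned by the two simple roots is complemented by the common fixed vectors, because
  the form is nondegenerate on it.\<close>

lemma act_relator:
  assumes st: "s \<in> S" "t \<in> S" and m: "cmatrix D s t = enat m"
  shows "act (alt_word s t (2 * m)) f = f"
proof (cases "s = t")
  case True
  then have "m = 1" using m cmatrix_refl[of s] st by (simp add: one_enat_def)
  then show ?thesis using True st by (simp add: numeral_2_eq_2 refl_refl)
next
  case False
  define \<phi> where "\<phi> = pi / real m"
  define c where "c = b s t"
  have m2: "2 \<le> m"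
    using cmatrix_ge_2[of s t] st False m by (auto simp: numeral_eq_enat)
  have "0 < sin \<phi>" using m2 by (intro sin_gt_zero) (auto simp: \<phi>_def field_simps)
  moreover have c: "c = - 2 * cos \<phi>" using m by (simp add: c_def b_def coxeter_angle_def \<phi>_def)
  ultimately have det: "4 - c * c \<noteq> 0"
    using sin_cos_squared_add[of \<phi>] by (auto simp: power2_eq_square)
  \<comment> \<open>Cramer's rule for the Gram matrix of the two simple roots: \<open>g\<close> is
    the orthogonal projection of \<open>f\<close> to their plane, and \<open>h\<close> is orthogonal
    to both.\<close>
  define p where "p = (2 * B (e s) f - c * B (e t) f) / (4 - c * c)"
  define q where "q = (2 * B (e t) f - c * B (e s) f) / (4 - c * c)"
  have pq: "2 * p + c * q = B (e s) f" "c * p + 2 * q = B (e t) f"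
    using det by (simp_all add: p_def q_def divide_simps) (simp_all add: algebra_simps)
  define g where "g = comb p (e s) q (e t)"
  define h where "h = comb 1 f (- 1) g"
  have "B (e s) h = 0" "B (e t) h = 0"
    using pq st by (simp_all add: h_def g_def form_comb_right form_simple_simple c_def b_sym[of t s]
        mult.commute)
  then have fix_h: "refl s h = h" "refl t h = h" by (simp_all add: reflection_def)
  have act_h: "act (alt_word x y n) h = h" if "{x, y} = {s, t}" for x y n
    using that by (induction n arbitrary: x y) (use fix_h in \<open>auto simp: doubleton_eq_iff\<close>)
  have fix_s: "act (alt_word s t (2 * m)) (e s) = e s"
    using st False m by (rule act_relator_simple)
  \<comment> \<open>By symmetry \<open>e t\<close> is fixed by the alternating word that ends in
    \<open>s\<close>, hence also by its reversal, which is the word in question.\<close>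
  have "act (alt_word t s (2 * m)) (e t) = e t"
    using st False m by (intro act_relator_simple) (auto simp: cmatrix_sym)
  then have "act (rev (alt_word t s (2 * m))) (act (alt_word t s (2 * m)) (e t)) =
      act (alt_word s t (2 * m)) (e t)"
    by (simp add: rev_alt_word)
  then have fix_t: "act (alt_word s t (2 * m)) (e t) = e t"
    using st by (simp add: act_rev_act alt_word_lists)
  have "f = comb 1 h 1 g" by (simp add: h_def comb_def)
  then show ?thesis
    using act_h[of s t "2 * m"] fix_s fix_t by (simp add: act_comb g_def)
qed

section \<open>The action depends only on the group element\<close>

lemma act_word_congr:
  assumes "word_congr S (coxeter_relator D) u v"
  shows "act u f = act v f"
  using assms
proof (induction arbitrary: f rule: word_congr.induct)
  case (base u v)
  from base(1) show ?case
    by cases (simp add: concat_replicate_alt_word act_relator)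
qed (auto)

lemma act_cong:
  "u \<in> lists S \<Longrightarrow> v \<in> lists S \<Longrightarrow> wprod u = wprod v \<Longrightarrow> act u f = act v f"
  by (simp add: wprod_eq_iff act_word_congr)

lemma coxeter_action_wprod:
  assumes "u \<in> lists S"
  shows "coxeter_action D (wprod u) f = act u f"
proof -
  have "(\<lambda>ss. act ss f) ` {ss \<in> lists S. wprod ss = wprod u} = {act u f}"
    using assms act_cong by (intro equalityI subsetI) (blast, blast)
  then show ?thesis by (simp add: coxeter_action_def)
qed

lemma roots_act: "roots D = {act u (e s) | u s. u \<in> lists S \<and> s \<in> S}"
proof (intro equalityI subsetI)
  fix f assume "f \<in> roots D"
  then obtain w s where f: "f = coxeter_action D w (e s)" "w \<in> carrier G" "s \<in> S"
    by (auto simp: roots_def)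
  obtain u where "u \<in> lists S" "wprod u = w" using wprod_surj[OF f(2)] .
  with f show "f \<in> {act u (e s) | u s. u \<in> lists S \<and> s \<in> S}"
    using coxeter_action_wprod[of u "e s"] by blast
next
  fix f assume "f \<in> {act u (e s) | u s. u \<in> lists S \<and> s \<in> S}"
  then obtain u s where "f = act u (e s)" "u \<in> lists S" "s \<in> S" by blast
  then show "f \<in> roots D"
    unfolding roots_def mem_Collect_eq using coxeter_action_wprod[of u "e s"] wprod_closed[of u]
    by metis
qed

subsection \<open>Positive and negative roots\<close>

definition nonneg :: "('w \<Rightarrow> real) \<Rightarrow> bool" where "nonneg f \<longleftrightarrow> (\<forall>s\<in>S. 0 \<le> f s)"
definition nonpos :: "('w \<Rightarrow> real) \<Rightarrow> bool" where "nonpos f \<longleftrightarrow> (\<forall>s\<in>S. f s \<le> 0)"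

text \<open>Reducedness in terms of length, for words in the generators. The predicate
  \<open>red\<close> below expresses reducedness through signs of roots instead.\<close>

definition word_min :: "'w list \<Rightarrow> bool" where
  "word_min w \<longleftrightarrow> w \<in> lists S \<and> (\<forall>u\<in>lists S. wprod u = wprod w \<longrightarrow> length w \<le> length u)"

lemma word_min_exists:
  assumes "w \<in> lists S"
  obtains u where "word_min u" "wprod u = wprod w"
proof -
  define P where "P u \<longleftrightarrow> u \<in> lists S \<and> wprod u = wprod w" for u
  have "P w" using assms by (simp add: P_def)
  then obtain u where "P u" "\<And>v. P v \<Longrightarrow> length u \<le> length v"
    using ex_has_least_nat[of P w length] by blast
  then show ?thesis using that[of u] by (auto simp: P_def word_min_def)
qed

lemma wprod_snoc_snoc: "u \<in> lists S \<Longrightarrow> s \<in> S \<Longrightarrow> wprod (u @ [s, s]) = wprod u"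
  using wprod_double[of u "[]" s] by simp

lemma wprod_snocD:
  assumes "wprod u = wprod (v @ [s])" "u \<in> lists S" "v \<in> lists S" "s \<in> S"
  shows "wprod (u @ [s]) = wprod v"
  using wprod_cong_append[of u "v @ [s]" "[s]" "[s]"] wprod_snoc_snoc[of v s] assms by simp

text \<open>A reduced word for \<open>w\<close> is split as \<open>v\<close> times an alternating word in \<open>s, t\<close>, with the
  alternating part as long as possible; then the induction hypothesis applies to \<open>v\<close> with both
  \<open>s\<close> and \<open>t\<close>, and the alternating part is computed in the plane of the two simple roots.\<close>

lemma nonneg_act_simple:
  assumes "word_min w" "s \<in> S"
    and "\<And>u. u \<in> lists S \<Longrightarrow> wprod u = wprod (w @ [s]) \<Longrightarrow> length w \<le> length u"
  shows "nonneg (act w (e s))"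
  using assms
proof (induction "length w" arbitrary: w s rule: less_induct)
  case less
  have w: "w \<in> lists S" and w_min: "\<And>u. u \<in> lists S \<Longrightarrow> wprod u = wprod w \<Longrightarrow> length w \<le> length u"
    using less.prems(1) by (auto simp: word_min_def)
  note s = less.prems(2) and ws_min = less.prems(3)
  show ?case
  proof (cases w rule: rev_cases)
    case Nil
    then show ?thesis by (simp add: nonneg_def simple_root_def)
  next
    case (snoc w' t)
    with w have w': "w' \<in> lists S" and t: "t \<in> S" by auto
    have st: "s \<noteq> t"
    proof
      assume "s = t"
      then have "length w \<le> length w'" using ws_min[of w'] snoc w' t wprod_snoc_snoc by simp
      with snoc show False by simp
    qed
    define P where "P j \<longleftrightarrow> (\<exists>v\<in>lists S. wprod (v @ alt_word s t j) = wprod w \<and> length v + j = length w)" for j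
    have "P 1" unfolding P_def using snoc w' by (intro bexI[of _ w']) auto
    moreover have "\<forall>j. P j \<longrightarrow> j \<le> length w" by (auto simp: P_def)
    ultimately obtain j where j: "P j" "\<And>i. P i \<Longrightarrow> i \<le> j"
      using Nat.ex_has_greatest_nat[of P 1 "length w"] by blast
    from \<open>P 1\<close> j have j1: "1 \<le> j" by blast
    from j(1) obtain v where v: "v \<in> lists S" "wprod (v @ alt_word s t j) = wprod w"
      "length v + j = length w" by (auto simp: P_def)
    note alt = alt_word_lists[OF s t]
    have v_min: "length v \<le> length u" if "u \<in> lists S" "wprod u = wprod v" for u
      using w_min[of "u @ alt_word s t j"] wprod_cong_append[of u v "alt_word s t j" "alt_word s t j"]
        that v alt by auto
    \<comment> \<open>\<open>p\<close> is the letter that would prolong the alternating word to the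
      left, \<open>q\<close> the letter with which it begins.\<close>
    define p where "p = (if even j then t else s)"
    define q where "q = (if even j then s else t)"
    have p: "p \<in> S" and q: "q \<in> S" using s t by (auto simp: p_def q_def)
    have alt_p: "p # alt_word s t j = alt_word s t (Suc j)"
      by (simp only: alt_word_Suc_left p_def)
    have alt_q: "alt_word s t j = q # alt_word s t (j - 1)"
      using j1 alt_word_Suc_left[of s t "j - 1"] by (auto simp: q_def)
    \<comment> \<open>A shorter word for \<open>v\<close> times \<open>p\<close> would give a longer
      alternating part, against the choice of \<open>j\<close>.\<close>
    have vp: "length v \<le> length u" if u: "u \<in> lists S" "wprod u = wprod (v @ [p])" for u
    proof (rule ccontr)
      assume less: "\<not> length v \<le> length u"
      have "wprod (u @ [p]) = wprod v"
        using wprod_snocD[of u v p] u v p by auto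
      then have "wprod (u @ alt_word s t (Suc j)) = wprod w"
        using wprod_cong_append[of "u @ [p]" v "alt_word s t j" "alt_word s t j"] u v p alt
        by (simp flip: alt_p del: alt_word.simps)
      moreover from this have "length w \<le> length u + Suc j"
        using w_min[of "u @ alt_word s t (Suc j)"] u alt[of "Suc j"] by (auto simp del: alt_word.simps)
      ultimately have "P (Suc j)"
        unfolding P_def using u v less by (intro bexI[of _ u]) auto
      with j(2) show False by fastforce
    qed
    \<comment> \<open>A shorter word for \<open>v\<close> times \<open>q\<close>, followed by the
      rest of the alternating part, would give a word for \<open>w\<close> that is too
      short.\<close>
    have vq: "length v \<le> length u" if u: "u \<in> lists S" "wprod u = wprod (v @ [q])" for u
    proof (rule ccontr)
      assume less: "\<not> length v \<le> length u"
      have "wprod (u @ alt_word s t (j - 1)) = wprod ((v @ [q]) @ alt_word s t (j - 1))"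
        using u v q alt by (intro wprod_cong_append) auto
      also have "\<dots> = wprod w" using v alt_q by simp
      finally have "length w \<le> length u + (j - 1)"
        using w_min[of "u @ alt_word s t (j - 1)"] u alt by auto
      with v less j1 show False by simp
    qed
    have "word_min v" using v v_min by (auto simp: word_min_def)
    moreover have "length v < length w" using v j1 by simp
    ultimately have "nonneg (act v (e p))" "nonneg (act v (e q))"
      using less.hyps[of v p] less.hyps[of v q] p q vp vq by blast+
    then have v_st: "nonneg (act v (e s))" "nonneg (act v (e t))"
      by (auto simp: p_def q_def split: if_splits)
    \<comment> \<open>Otherwise a braid move makes \<open>w\<close> end in \<open>s\<close>, and
      multiplying by \<open>s\<close> shortens it, against the hypothesis on
      \<open>w @ [s]\<close>.\<close>
    have jm: "enat (Suc j) \<le> cmatrix D s t"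
    proof (rule ccontr)
      assume "\<not> ?thesis"
      then obtain m where m: "cmatrix D s t = enat m" "m \<le> j"
        by (cases "cmatrix D s t") auto
      have m2: "2 \<le> m" using cmatrix_ge_2[OF s t st] m by (simp add: numeral_eq_enat)
      define a where "a = (if even m then alt_word s t (j - m) else alt_word t s (j - m))"
      have a: "a \<in> lists S" "length a = j - m"
        using alt alt_word_lists[OF t s] by (auto simp: a_def)
      have "alt_word s t j = a @ alt_word s t m"
        using alt_word_add[of s t "j - m" m] m by (simp add: a_def)
      then have "wprod w = wprod ((v @ a) @ alt_word s t m)" using v by simp
      also have "\<dots> = wprod ((v @ a) @ alt_word t s m)"
        using wprod_braid[OF s t m(1)] v a alt alt_word_lists[OF t s] by (intro wprod_cong_append) auto
      also have "alt_word t s m = alt_word s t (m - 1) @ [s]"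
        using m2 by (cases m) auto
      finally have "wprod (w @ [s]) = wprod (((v @ a) @ alt_word s t (m - 1)) @ [s, s])"
        using wprod_cong_append[of w "v @ a @ alt_word s t (m - 1) @ [s]" "[s]" "[s]"] w v a s alt by simp
      also have "\<dots> = wprod ((v @ a) @ alt_word s t (m - 1))"
        using v a alt s by (intro wprod_snoc_snoc) auto
      finally have "length w \<le> length ((v @ a) @ alt_word s t (m - 1))"
        using v a alt by (intro ws_min) auto
      with v m m2 a show False by simp
    qed
    define x y where "x = (if even j then cheb (b s t) (Suc j) else cheb (b s t) j)"
      and "y = (if even j then cheb (b s t) j else cheb (b s t) (Suc j))"
    have "enat j \<le> cmatrix D s t" using jm by (metis Suc_ile_eq order.strict_implies_order)
    with cheb_b_nonneg[OF s t st jm] cheb_b_nonneg[OF s t st, of j]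
    have xy: "0 \<le> x" "0 \<le> y" by (auto simp: x_def y_def simp del: cheb.simps)
    have "act w (e s) = act (v @ alt_word s t j) (e s)"
      using v w alt by (intro act_cong) auto
    also have "\<dots> = comb x (act v (e s)) y (act v (e t))"
      using act_alt_word_simple[OF s t, of j] by (simp add: act_comb x_def y_def del: cheb.simps)
    finally show ?thesis using v_st xy by (auto simp: nonneg_def comb_def)
  qed
qed

lemma simple_in_roots: "s \<in> S \<Longrightarrow> e s \<in> roots D"
  unfolding roots_act by (intro CollectI exI[of _ "[]"] exI[of _ s]) auto

lemma act_in_roots:
  assumes "f \<in> roots D" "u \<in> lists S"
  shows "act u f \<in> roots D"
proof -
  obtain v s where "f = act v (e s)" "v \<in> lists S" "s \<in> S" using assms by (auto simp: roots_act)
  with assms show ?thesis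
    unfolding roots_act by (intro CollectI exI[of _ "u @ v"] exI[of _ s]) auto
qed

lemma refl_in_roots: "f \<in> roots D \<Longrightarrow> s \<in> S \<Longrightarrow> refl s f \<in> roots D"
  using act_in_roots[of f "[s]"] by simp

lemma refl_simple_self: "s \<in> S \<Longrightarrow> refl s (e s) = (\<lambda>t. - e s t)"
  by (simp add: refl_comb_def form_simple_simple) (simp add: comb_def)

lemma act_uminus: "act u (\<lambda>t. - f t) = (\<lambda>t. - act u f t)"
  using act_comb[of u "- 1" f 0 f] by (simp add: comb_def)

lemma roots_uminus: "f \<in> roots D \<Longrightarrow> (\<lambda>t. - f t) \<in> roots D"
proof -
  assume "f \<in> roots D"
  then obtain u s where "f = act u (e s)" "u \<in> lists S" "s \<in> S" by (auto simp: roots_act)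
  then show ?thesis
    unfolding roots_act
    by (intro CollectI exI[of _ "u @ [s]"] exI[of _ s]) (auto simp: refl_simple_self act_uminus)
qed

lemma root_norm: "f \<in> roots D \<Longrightarrow> B f f = 2"
  unfolding roots_act using form_act form_simple_simple by force

lemma root_outside: "f \<in> roots D \<Longrightarrow> t \<notin> S \<Longrightarrow> f t = 0"
  by (auto simp: roots_act) (metis act_outside in_listsD simple_root_def)

text \<open>Let \<open>w\<close> and \<open>u\<close> be reduced words with \<open>u\<close>
  representing \<open>w\<close> times \<open>s\<close>. If \<open>w\<close> is not longer than
  \<open>u\<close>, then \<open>nonneg_act_simple\<close> applies to \<open>w\<close>; otherwise it
  applies to \<open>u\<close>, which sends \<open>e s\<close> to the negative of the root.\<close>

lemma root_sign:
  assumes "f \<in> roots D"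
  shows "nonneg f \<or> nonpos f"
proof -
  obtain w0 s where f: "f = act w0 (e s)" "w0 \<in> lists S" and s: "s \<in> S"
    using assms by (auto simp: roots_act)
  obtain w where w: "word_min w" "wprod w = wprod w0" using word_min_exists[OF f(2)] .
  have wS: "w \<in> lists S" using w by (simp add: word_min_def)
  have fw: "f = act w (e s)" using f w wS act_cong[of w w0] by simp
  obtain u where u: "word_min u" "wprod u = wprod (w @ [s])"
    using word_min_exists[of "w @ [s]"] wS s by auto
  have uS: "u \<in> lists S" using u by (simp add: word_min_def)
  show ?thesis
  proof (cases "length w \<le> length u")
    case True
    have "nonneg (act w (e s))"
    proof (rule nonneg_act_simple[OF w(1) s])
      fix v assume "v \<in> lists S" "wprod v = wprod (w @ [s])"
      with u True show "length w \<le> length v" by (fastforce simp: word_min_def)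
    qed
    with fw show ?thesis by simp
  next
    case False
    have us: "wprod (u @ [s]) = wprod w" using u uS wS s by (intro wprod_snocD)
    have "nonneg (act u (e s))"
    proof (rule nonneg_act_simple[OF u(1) s])
      fix v assume "v \<in> lists S" "wprod v = wprod (u @ [s])"
      with w us False show "length u \<le> length v" by (fastforce simp: word_min_def)
    qed
    moreover have "f = act (u @ [s]) (e s)"
      unfolding fw using us uS wS s by (intro act_cong) auto
    then have "f = (\<lambda>t. - act u (e s) t)" using s by (simp add: refl_simple_self act_uminus)
    ultimately show ?thesis by (auto simp: nonneg_def nonpos_def)
  qed
qed

lemma root_not_both: "f \<in> roots D \<Longrightarrow> nonneg f \<Longrightarrow> nonpos f \<Longrightarrow> False"
proof -
  assume f: "f \<in> roots D" "nonneg f" "nonpos f"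
  then have "\<forall>s\<in>S. f s = 0" by (force simp: nonneg_def nonpos_def)
  then have "B f f = 0" by (simp add: form_b)
  with root_norm[OF f(1)] show False by simp
qed

lemma nonneg_uminus [simp]: "nonneg (\<lambda>t. - f t) = nonpos f"
  and nonpos_uminus [simp]: "nonpos (\<lambda>t. - f t) = nonneg f"
  by (auto simp: nonneg_def nonpos_def)

lemma nonneg_simple: "nonneg (e s)"
  by (simp add: nonneg_def simple_root_def)

text \<open>The root is a multiple of \<open>e s\<close>; its norm 2 leaves the factors 1 and -1,
  and the sign decides.\<close>

lemma root_eq_simple:
  assumes f: "f \<in> roots D" "nonneg f" and s: "s \<in> S" and "\<And>t. t \<in> S \<Longrightarrow> t \<noteq> s \<Longrightarrow> f t = 0"
  shows "f = e s"
proof -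
  have eq: "f = comb (f s) (e s) 0 f"
  proof
    fix t show "f t = comb (f s) (e s) 0 f t"
      using assms root_outside[OF f(1), of t] by (cases "t = s") (auto simp: comb_def)
  qed
  have "f s * (2 * f s) = 2"
    using root_norm[OF f(1)] s
    by (subst (asm) (1 2) eq) (simp add: form_comb_left form_comb_right form_simple_simple)
  moreover have "0 \<le> f s" using f s by (simp add: nonneg_def)
  ultimately have "f s = 1"
    using power2_eq_1_iff[of "f s"] by (simp add: power2_eq_square)
  with eq show ?thesis by (simp add: comb_def)
qed

text \<open>The reflection changes only the coordinate at \<open>s\<close>, so every other
  coordinate is both nonnegative and nonpositive.\<close>

lemma refl_sign_change:
  assumes f: "f \<in> roots D" "nonneg f" and s: "s \<in> S" and "nonpos (refl s f)"
  shows "f = e s"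
proof (rule root_eq_simple[OF f s])
  fix t assume t: "t \<in> S" "t \<noteq> s"
  then have "refl s f t = f t" by (intro refl_outside)
  with assms t show "f t = 0" by (force simp: nonneg_def nonpos_def)
qed

end

section \<open>Admissible words and their multiplicities\<close>

locale coxeter_elt = coxeter D for D :: "('w, 'v) coxeter_data" +
  fixes c :: 'w
  assumes cox_elt: "coxeter_element D c"
begin

abbreviation V where "V \<equiv> cverts D"
abbreviation l where "l \<equiv> clabel D"
abbreviation E where "E \<equiv> coxeter_edge D"
abbreviation Q0 where "Q0 \<equiv> c_orientation D c"
abbreviation Q where "Q xs \<equiv> foldr reverse_at xs Q0"
abbreviation adm where "adm \<equiv> admissible_word D c"
abbreviation cnt where "cnt \<equiv> count_list"

definition cword :: "'w list" where
  "cword = (SOME ss. coxeter_word D c ss)"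

text \<open>The orientation as a number, so that it can enter linear relations between
  multiplicities.\<close>

definition \<epsilon> :: "'v \<Rightarrow> 'v \<Rightarrow> nat" where
  "\<epsilon> x y = (if (x, y) \<in> Q0 then 1 else 0)"

lemma cword: "distinct cword" "set cword = S"
  using someI_ex[OF cox_elt[unfolded coxeter_element_def]]
  by (auto simp: cword_def coxeter_word_def)

lemma label_in [simp]: "x \<in> V \<Longrightarrow> l x \<in> S"
  using bij_clabel by (auto simp: bij_betw_def)

lemma label_eq_iff: "x \<in> V \<Longrightarrow> y \<in> V \<Longrightarrow> l x = l y \<longleftrightarrow> x = y"
  using bij_clabel by (auto simp: bij_betw_def inj_on_def)

lemma finite_verts: "finite V"
  using bij_betw_finite[OF bij_clabel] finite_cgens by simp

lemma E_sym: "E x y \<longleftrightarrow> E y x"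
  unfolding coxeter_edge_def by (metis cmatrix_sym label_in)

lemma E_verts: "E x y \<Longrightarrow> x \<in> V \<and> y \<in> V \<and> x \<noteq> y"
  by (simp add: coxeter_edge_def)

lemma Q0_iff: "(x, y) \<in> Q0 \<longleftrightarrow>
  E x y \<and> (\<exists>i j. i < j \<and> j < length cword \<and> cword ! i = l x \<and> cword ! j = l y)"
  by (simp add: c_orientation_def cword_def word_orientation_def)

lemma Q0_edge: "(x, y) \<in> Q0 \<Longrightarrow> E x y"
  by (simp add: Q0_iff)

lemma Q0_total:
  assumes "E x y"
  shows "(x, y) \<in> Q0 \<longleftrightarrow> (y, x) \<notin> Q0"
proof -
  have xy: "x \<in> V" "y \<in> V" "x \<noteq> y" using E_verts[OF assms] by auto
  obtain i j where ij: "i < length cword" "cword ! i = l x" "j < length cword" "cword ! j = l y"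
    using xy cword by (metis in_set_conv_nth label_in)
  have eq: "i' = i" if "i' < length cword" "cword ! i' = l x" for i'
    using that ij cword by (metis nth_eq_iff_index_eq)
  have eq': "j' = j" if "j' < length cword" "cword ! j' = l y" for j'
    using that ij cword by (metis nth_eq_iff_index_eq)
  have "i \<noteq> j" using ij xy label_eq_iff by auto
  have "(x, y) \<in> Q0 \<longleftrightarrow> i < j"
    unfolding Q0_iff using assms ij eq eq' by (metis less_trans)
  moreover have "(y, x) \<in> Q0 \<longleftrightarrow> j < i"
    unfolding Q0_iff using assms E_sym[of y x] ij eq eq' by (metis less_trans)
  ultimately show ?thesis using \<open>i \<noteq> j\<close> by auto
qed

lemma \<epsilon>_swap: "E x y \<Longrightarrow> \<epsilon> x y + \<epsilon> y x = 1"
  using Q0_total by (auto simp: \<epsilon>_def)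

text \<open>Every occurrence of an endpoint turns the arrow around, so only the parity of the
  occurrences matters.\<close>

lemma Q_iff:
  "(x, y) \<in> Q xs \<longleftrightarrow> E x y \<and> ((x, y) \<in> Q0 \<longleftrightarrow> even (cnt xs x + cnt xs y))"
proof (induction xs arbitrary: x y)
  case Nil
  then show ?case using Q0_edge by auto
next
  case (Cons z xs)
  have "E x y \<Longrightarrow> x \<noteq> y" using E_verts by blast
  then show ?case
    using Cons[of x y] Cons[of y x] Q0_total[of x y] E_sym[of x y]
    by (auto simp: reverse_at_def)
qed

lemma adm_verts: "adm xs \<Longrightarrow> xs \<in> lists V"
  by (induction xs) (auto simp: is_sink_def)

lemma sink_parity:
  assumes "is_sink D (Q xs) x" "E x y"
  shows "odd (cnt xs x + cnt xs y + \<epsilon> y x)"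
  using assms Q_iff[of x y xs] Q0_total[of x y] by (auto simp: is_sink_def \<epsilon>_def)

text \<open>The bounds leave two consecutive values, and parity selects one.\<close>

lemma parity_eq: "odd (m + n + q) \<Longrightarrow> p + q = 1 \<Longrightarrow> n \<le> m + p \<and> m + p \<le> n + 1 \<Longrightarrow> n = m + p"
  for m n p q :: nat
  by presburger

text \<open>This is the alternation of letters along an edge:
  \<open>cnt xs x + \<epsilon> x y - cnt xs y\<close> stays in {0, 1}, because \<open>x\<close> can
  be a sink only at the value 0 and \<open>y\<close> only at the value 1.\<close>

lemma adm_bounds:
  assumes "adm xs" "E x y"
  shows "cnt xs y \<le> cnt xs x + \<epsilon> x y \<and> cnt xs x + \<epsilon> x y \<le> cnt xs y + 1"
  using assms
proof (induction xs)
  case Nil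
  then show ?case by (simp add: \<epsilon>_def)
next
  case (Cons z xs)
  have xy: "x \<noteq> y" "E y x" using Cons.prems E_verts E_sym by blast+
  note sw = \<epsilon>_swap[OF Cons.prems(2)]
  have IH: "cnt xs y \<le> cnt xs x + \<epsilon> x y \<and> cnt xs x + \<epsilon> x y \<le> cnt xs y + 1"
    using Cons by simp
  consider "z = x" | "z = y" | "z \<noteq> x" "z \<noteq> y" by blast
  then show ?case
  proof cases
    case 1
    have "odd (cnt xs x + cnt xs y + \<epsilon> y x)"
      using sink_parity[of xs x y] Cons.prems 1 by simp
    then have "cnt xs y = cnt xs x + \<epsilon> x y"
      using IH sw by (blast intro: parity_eq)
    then show ?thesis using 1 xy by simp
  next
    case 2
    have "odd (cnt xs y + cnt xs x + \<epsilon> x y)"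
      using sink_parity[of xs y x] Cons.prems 2 xy by simp
    then have "cnt xs y \<noteq> cnt xs x + \<epsilon> x y" by presburger
    then show ?thesis using 2 xy IH by simp
  next
    case 3
    then show ?thesis using IH by simp
  qed
qed

text \<open>From here on admissibility is a system of equations between multiplicities; the
  orientation at intermediate stages is eliminated by parity and \<open>adm_bounds\<close>.\<close>

lemma adm_Cons:
  "adm (x # xs) \<longleftrightarrow> adm xs \<and> x \<in> V \<and> (\<forall>y. E x y \<longrightarrow> cnt xs y = cnt xs x + \<epsilon> x y)"
proof -
  have "is_sink D (Q xs) x \<longleftrightarrow> x \<in> V \<and> (\<forall>y. E x y \<longrightarrow> cnt xs y = cnt xs x + \<epsilon> x y)" if "adm xs"
  proof
    assume sink: "is_sink D (Q xs) x"
    have "cnt xs y = cnt xs x + \<epsilon> x y" if "E x y" for y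
      using sink_parity[OF sink that] \<epsilon>_swap[OF that] adm_bounds[OF \<open>adm xs\<close> that]
      by (blast intro: parity_eq)
    with sink show "x \<in> V \<and> (\<forall>y. E x y \<longrightarrow> cnt xs y = cnt xs x + \<epsilon> x y)"
      by (simp add: is_sink_def)
  next
    assume *: "x \<in> V \<and> (\<forall>y. E x y \<longrightarrow> cnt xs y = cnt xs x + \<epsilon> x y)"
    then have "(x, y) \<notin> Q xs" for y
      using Q_iff[of x y xs] by (auto simp: \<epsilon>_def split: if_splits)
    with * show "is_sink D (Q xs) x" by (simp add: is_sink_def)
  qed
  then show ?thesis by auto
qed

lemma adm_append: "adm (xs @ ys) \<Longrightarrow> adm ys"
  by (induction xs) auto

text \<open>The letters of \<open>ys\<close> are read from the right, and a letter is put in front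
  whenever its multiplicity exceeds the one already reached.\<close>

lemma adm_join:
  assumes "adm xs" "adm ys"
  shows "\<exists>zs. adm (zs @ xs) \<and> (\<forall>x. cnt (zs @ xs) x = max (cnt xs x) (cnt ys x))"
  using assms(2)
proof (induction ys)
  case Nil
  then show ?case using assms(1) by (intro exI[of _ "[]"]) simp
next
  case (Cons y ys)
  then obtain zs where zs: "adm (zs @ xs)" "\<And>x. cnt (zs @ xs) x = max (cnt xs x) (cnt ys x)"
    by (auto simp: adm_Cons)
  show ?case
  proof (cases "cnt (y # ys) y \<le> cnt xs y")
    case True
    with zs show ?thesis by (intro exI[of _ zs]) auto
  next
    case False
    have y: "y \<in> V" "\<And>t. E y t \<Longrightarrow> cnt ys t = cnt ys y + \<epsilon> y t"
      using Cons.prems unfolding adm_Cons by auto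
    have zy: "cnt (zs @ xs) y = cnt ys y" using False zs(2)[of y] by simp
    \<comment> \<open>The maximum with \<open>ys\<close> bounds the multiplicity of the neighbour
      \<open>t\<close> from below, \<open>adm_bounds\<close> from above.\<close>
    have "cnt (zs @ xs) t = cnt (zs @ xs) y + \<epsilon> y t" if "E y t" for t
      using adm_bounds[OF zs(1) that] y(2)[OF that] zs(2)[of t] zy by linarith
    then have "adm (y # zs @ xs)" using zs(1) y(1) adm_Cons by blast
    moreover have "cnt (y # zs @ xs) x = max (cnt xs x) (cnt (y # ys) x)" for x
      using zs(2)[of x] zy False by auto
    ultimately show ?thesis by (intro exI[of _ "y # zs"]) simp
  qed
qed

text \<open>Here a letter of \<open>ys\<close> is kept as long as \<open>xs\<close> still has more
  occurrences of it.\<close>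

lemma adm_meet:
  assumes "adm xs" "adm ys"
  shows "\<exists>zs. adm zs \<and> (\<forall>x. cnt zs x = min (cnt xs x) (cnt ys x))"
  using assms(2)
proof (induction ys)
  case Nil
  then show ?case by (intro exI[of _ "[]"]) simp
next
  case (Cons y ys)
  then obtain zs where zs: "adm zs" "\<And>x. cnt zs x = min (cnt xs x) (cnt ys x)"
    by (auto simp: adm_Cons)
  show ?case
  proof (cases "cnt xs y \<le> cnt ys y")
    case True
    with zs show ?thesis by (intro exI[of _ zs]) auto
  next
    case False
    have y: "y \<in> V" "\<And>t. E y t \<Longrightarrow> cnt ys t = cnt ys y + \<epsilon> y t"
      using Cons.prems unfolding adm_Cons by auto
    have zy: "cnt zs y = cnt ys y" using False zs(2)[of y] by simp
    \<comment> \<open>Since \<open>xs\<close> has at least one more \<open>y\<close> than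
      \<open>ys\<close>, alternation in \<open>xs\<close> gives it at least as many \<open>t\<close>
      as \<open>ys\<close>, so the minimum at \<open>t\<close> is attained by
      \<open>ys\<close>.\<close>
    have "cnt zs t = cnt zs y + \<epsilon> y t" if "E y t" for t
      using adm_bounds[OF assms(1) that] y(2)[OF that] zs(2)[of t] zy False by linarith
    then have "adm (y # zs)" using zs(1) y(1) adm_Cons by blast
    moreover have "cnt (y # zs) x = min (cnt xs x) (cnt (y # ys) x)" for x
      using zs(2)[of x] zy False by auto
    ultimately show ?thesis by blast
  qed
qed

lemma adm_extend:
  assumes "adm xs" "adm ys" "\<And>x. cnt ys x \<le> cnt xs x"
  shows "\<exists>zs. adm (zs @ ys) \<and> (\<forall>x. cnt (zs @ ys) x = cnt xs x)"
  using adm_join[OF assms(2,1)] assms(3) by (simp add: max_def)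

section \<open>Multiplicities determine the commutation class\<close>

abbreviation gc where "gc \<equiv> word_congr V (graph_relator D)"

lemma gc_Cons: "x \<in> V \<Longrightarrow> gc u v \<Longrightarrow> gc (x # u) (x # v)"
  using word_congr.append[of V _ "[x]" "[x]" u v] word_congr.refl[of "[x]" V] by simp

lemma gc_move:
  assumes "x \<in> V" "us \<in> lists V" "\<And>u. u \<in> set us \<Longrightarrow> u \<noteq> x \<and> \<not> E u x"
  shows "gc (us @ [x]) (x # us)"
  using assms(2,3)
proof (induction us rule: list.induct)
  case Nil
  then show ?case using assms(1) by (auto intro: word_congr.refl)
next
  case (Cons u us)
  have u: "u \<in> V" "us \<in> lists V" "u \<noteq> x" "\<not> E u x"
    using Cons.prems(1) Cons.prems(2)[of u] by simp_all
  have "gc (u # us @ [x]) (u # x # us)"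
    using Cons u by (intro gc_Cons) auto
  moreover have "gc [u, x] [x, u]"
    using u assms(1) by (intro word_congr.base) (auto intro: graph_relator.intros)
  then have "gc ([u, x] @ us) ([x, u] @ us)"
    using u by (intro word_congr.append word_congr.refl)
  ultimately show ?case by (auto intro: word_congr.trans)
qed

lemma gc_cnt: "gc u v \<Longrightarrow> cnt u x = cnt v x"
  by (induction rule: word_congr.induct) (auto elim!: graph_relator.cases)

text \<open>The conditions on the letters of \<open>us\<close> concern only multiplicities of
  letters other than \<open>x\<close>.\<close>

lemma adm_delete:
  assumes "adm (us @ x # ws)" "\<And>u. u \<in> set us \<Longrightarrow> u \<noteq> x \<and> \<not> E u x"
  shows "adm (us @ ws)"
  using assms
proof (induction us)
  case Nil
  then show ?case by simp
next
  case (Cons u us)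
  have IH: "adm (us @ ws)" using Cons by simp
  have u: "u \<noteq> x" "\<not> E u x" using Cons.prems by auto
  show ?case
    unfolding append_Cons adm_Cons
  proof (intro conjI allI impI)
    show "adm (us @ ws)" by fact
    have adm: "adm (u # us @ x # ws)" using Cons.prems by simp
    then show "u \<in> V" by (simp only: adm_Cons)
    fix y assume y: "E u y"
    then have "x \<noteq> y" using u by auto
    moreover have "cnt (us @ x # ws) y = cnt (us @ x # ws) u + \<epsilon> u y"
      using adm y by (simp only: adm_Cons)
    ultimately show "cnt (us @ ws) y = cnt (us @ ws) u + \<epsilon> u y" using u by auto
  qed
qed

text \<open>The first letter \<open>x\<close> of \<open>xs\<close> is located at its leftmost
  occurrence in \<open>ys\<close>. No neighbour of \<open>x\<close> stands to the left of it, so it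
  can be commuted to the front and deleted from both words.\<close>

lemma adm_same_cnt:
  assumes "adm xs" "adm ys" "\<And>x. cnt xs x = cnt ys x"
  shows "gc xs ys"
  using assms
proof (induction xs arbitrary: ys)
  case Nil
  then have "ys = []" by (metis count_list.simps(1) count_list_0_iff list.set_intros(1) neq_Nil_conv)
  then show ?case by (auto intro: word_congr.refl)
next
  case (Cons x xs)
  have x: "x \<in> V" "\<And>t. E x t \<Longrightarrow> cnt xs t = cnt xs x + \<epsilon> x t" and xs: "adm xs"
    using Cons.prems(1) by (auto simp only: adm_Cons)
  have "x \<in> set ys" using Cons.prems(3)[of x] by (metis count_list_0_iff list.set_intros(1))
  then obtain us ws where ys: "ys = us @ x # ws" "x \<notin> set us"
    by (meson split_list_first)
  have V: "us \<in> lists V" "ws \<in> lists V" using adm_verts[OF Cons.prems(2)] ys by auto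
  have adm_ws: "adm (x # ws)" using Cons.prems(2) adm_append ys by blast
  then have w: "\<And>t. E x t \<Longrightarrow> cnt ws t = cnt ws x + \<epsilon> x t" by (simp only: adm_Cons)
  have cx: "cnt xs x = cnt ws x" using Cons.prems(3)[of x] ys by simp
  have us: "u \<noteq> x \<and> \<not> E u x" if u: "u \<in> set us" for u
  proof
    show "u \<noteq> x" using u ys by auto
    show "\<not> E u x"
    proof
      assume "E u x"
      then have xu: "E x u" "u \<noteq> x" using E_sym E_verts by blast+
      \<comment> \<open>Both words prescribe the same multiplicity of \<open>u\<close> at the moment
        when this \<open>x\<close> is added, and that already exhausts the occurrences of
        \<open>u\<close> in \<open>ys\<close>.\<close>
      have "cnt us u = 0"
        using Cons.prems(3)[of u] ys w[OF xu(1)] x(2)[OF xu(1)] cx xu by simp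
      with u show False by (simp add: count_list_0_iff)
    qed
  qed
  have "gc xs (us @ ws)"
  proof (rule Cons.IH[OF xs])
    show "adm (us @ ws)" using adm_delete[OF _ us] Cons.prems(2) ys by blast
    show "cnt xs y = cnt (us @ ws) y" for y
      using Cons.prems(3)[of y] ys by (auto split: if_splits)
  qed
  then have 1: "gc (x # xs) (x # us @ ws)" using x(1) by (intro gc_Cons)
  have "gc (x # us) (us @ [x])" using gc_move[OF x(1) V(1) us] by (rule word_congr.sym)
  then have "gc ((x # us) @ ws) ((us @ [x]) @ ws)"
    using V by (intro word_congr.append word_congr.refl)
  with 1 show ?case using ys by (auto intro: word_congr.trans)
qed

subsection \<open>The lattice of admissible elements\<close>

definition cl :: "'v list \<Rightarrow> 'v list set" where
  "cl xs = {w. gc xs w}"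

abbreviation vact where "vact xs \<equiv> act (map l xs)"

lemma carrier_graph_monoid: "carrier (graph_monoid D) = cl ` lists V"
  by (auto simp: graph_monoid_def presented_monoid_def quotient_def cl_def)

lemma gc_in_cl: "xs \<in> lists V \<Longrightarrow> xs \<in> cl xs"
  by (simp add: cl_def word_congr.refl)

lemma cl_eq_iff:
  assumes "u \<in> lists V" "v \<in> lists V"
  shows "cl u = cl v \<longleftrightarrow> gc u v"
proof
  assume "cl u = cl v"
  then show "gc u v" using gc_in_cl[OF assms(2)] by (auto simp: cl_def)
next
  assume uv: "gc u v"
  have "gc u w \<longleftrightarrow> gc v w" for w
    using word_congr.trans[OF uv] word_congr.trans[OF word_congr.sym[OF uv]] by blast
  then show "cl u = cl v" by (simp add: cl_def)
qed

lemma mult_graph_monoid: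
  assumes "u \<in> lists V" "v \<in> lists V"
  shows "cl u \<otimes>\<^bsub>graph_monoid D\<^esub> cl v = cl (u @ v)"
proof -
  have "(\<exists>a\<in>cl u. \<exists>b\<in>cl v. gc (a @ b) w) \<longleftrightarrow> gc (u @ v) w" for w
  proof
    assume "\<exists>a\<in>cl u. \<exists>b\<in>cl v. gc (a @ b) w"
    then obtain a b where "gc u a" "gc v b" and w: "gc (a @ b) w" by (auto simp: cl_def)
    then have "gc (u @ v) (a @ b)" by (intro word_congr.append)
    then show "gc (u @ v) w" using w by (rule word_congr.trans)
  next
    assume "gc (u @ v) w"
    then show "\<exists>a\<in>cl u. \<exists>b\<in>cl v. gc (a @ b) w"
      using assms gc_in_cl by blast
  qed
  then show ?thesis by (simp add: graph_monoid_def presented_monoid_def cl_def)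
qed

lemma admissible_cl: "admissible D c = cl ` {xs. adm xs}"
proof (intro equalityI subsetI)
  fix X assume "X \<in> admissible D c"
  then obtain u xs where "X = cl u" "u \<in> lists V" "xs \<in> X" "adm xs"
    by (auto simp: admissible_def carrier_graph_monoid)
  moreover from this have "cl u = cl xs"
    using adm_verts[of xs] by (subst cl_eq_iff) (auto simp: cl_def)
  ultimately show "X \<in> cl ` {xs. adm xs}" by auto
next
  fix X assume "X \<in> cl ` {xs. adm xs}"
  then obtain xs where "X = cl xs" "adm xs" by blast
  then show "X \<in> admissible D c"
    using adm_verts[of xs] gc_in_cl[of xs] by (auto simp: admissible_def carrier_graph_monoid)
qed

text \<open>Multiplicities are invariants of the class. Conversely \<open>adm_extend\<close>
  prolongs \<open>ys\<close> to a word with the multiplicities of \<open>xs\<close>, which lies in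
  the class of \<open>xs\<close>.\<close>

lemma le_cl:
  assumes "adm xs" "adm ys"
  shows "graph_monoid_le D (cl ys) (cl xs) \<longleftrightarrow> (\<forall>z. cnt ys z \<le> cnt xs z)"
proof
  assume "graph_monoid_le D (cl ys) (cl xs)"
  then obtain u where "u \<in> lists V" "cl xs = cl u \<otimes>\<^bsub>graph_monoid D\<^esub> cl ys"
    by (auto simp: graph_monoid_le_def carrier_graph_monoid)
  then have "gc xs (u @ ys)"
    using assms adm_verts by (simp add: mult_graph_monoid cl_eq_iff)
  then show "\<forall>z. cnt ys z \<le> cnt xs z" by (simp add: gc_cnt)
next
  assume "\<forall>z. cnt ys z \<le> cnt xs z"
  then obtain zs where zs: "adm (zs @ ys)" "\<And>x. cnt (zs @ ys) x = cnt xs x"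
    using adm_extend[OF assms] by blast
  then have "gc xs (zs @ ys)" using assms adm_same_cnt by simp
  moreover have V: "zs @ ys \<in> lists V" using zs adm_verts by blast
  ultimately have "cl xs = cl (zs @ ys)" using assms adm_verts by (subst cl_eq_iff) auto
  with V show "graph_monoid_le D (cl ys) (cl xs)"
    unfolding graph_monoid_le_def carrier_graph_monoid
    by (intro bexI[of _ "cl zs"]) (auto simp: mult_graph_monoid)
qed

lemma cl_eqI: "adm xs \<Longrightarrow> adm ys \<Longrightarrow> (\<And>x. cnt xs x = cnt ys x) \<Longrightarrow> cl xs = cl ys"
  using adm_same_cnt[of xs ys] adm_verts[of xs] adm_verts[of ys] cl_eq_iff[of xs ys] by blast

abbreviation L where "L \<equiv> admissible_order D c"

lemma L_simps: "carrier L = admissible D c" "x .=\<^bsub>L\<^esub> y \<longleftrightarrow> x = y" "x \<sqsubseteq>\<^bsub>L\<^esub> y \<longleftrightarrow> graph_monoid_le D x y"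
  by (simp_all add: admissible_order_def)

lemma L_partial_order: "partial_order L"
proof
  fix X Y Z assume "X \<in> carrier L" "Y \<in> carrier L" "Z \<in> carrier L"
    and "X \<sqsubseteq>\<^bsub>L\<^esub> Y" "Y \<sqsubseteq>\<^bsub>L\<^esub> Z"
  then show "X \<sqsubseteq>\<^bsub>L\<^esub> Z"
    by (auto simp: L_simps admissible_cl le_cl) (meson order_trans)
next
  fix X Y assume "X \<in> carrier L" "Y \<in> carrier L" "X \<sqsubseteq>\<^bsub>L\<^esub> Y" "Y \<sqsubseteq>\<^bsub>L\<^esub> X"
  then obtain xs ys where "X = cl xs" "Y = cl ys" "adm xs" "adm ys"
    "\<forall>z. cnt xs z \<le> cnt ys z" "\<forall>z. cnt ys z \<le> cnt xs z"
    by (auto simp: L_simps admissible_cl le_cl)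
  then have "cl xs = cl ys" by (intro cl_eqI order_antisym) auto
  with \<open>X = cl xs\<close> \<open>Y = cl ys\<close> show "X .=\<^bsub>L\<^esub> Y" by (simp add: L_simps)
next
  fix X assume "X \<in> carrier L"
  then show "X \<sqsubseteq>\<^bsub>L\<^esub> X" by (auto simp: L_simps admissible_cl le_cl)
qed (simp_all add: L_simps fun_eq_iff)

lemma L_least:
  assumes "adm xs" "adm ys" "adm zs" "\<And>x. cnt zs x = max (cnt xs x) (cnt ys x)"
  shows "least L (cl zs) (Upper L {cl xs, cl ys})"
proof -
  have Upper: "Upper L {cl xs, cl ys} = {u \<in> carrier L. cl xs \<sqsubseteq>\<^bsub>L\<^esub> u \<and> cl ys \<sqsubseteq>\<^bsub>L\<^esub> u}"
    using assms(1,2) by (auto simp: Upper_def L_simps admissible_cl)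
  show ?thesis
    unfolding least_def Upper
  proof (intro conjI ballI)
    show "cl zs \<in> {u \<in> carrier L. cl xs \<sqsubseteq>\<^bsub>L\<^esub> u \<and> cl ys \<sqsubseteq>\<^bsub>L\<^esub> u}"
      using assms(1-3) by (simp add: L_simps admissible_cl le_cl assms(4))
    fix u assume "u \<in> {u \<in> carrier L. cl xs \<sqsubseteq>\<^bsub>L\<^esub> u \<and> cl ys \<sqsubseteq>\<^bsub>L\<^esub> u}"
    then obtain us where "u = cl us" "adm us" "cl xs \<sqsubseteq>\<^bsub>L\<^esub> cl us" "cl ys \<sqsubseteq>\<^bsub>L\<^esub> cl us"
      by (auto simp: L_simps admissible_cl)
    then show "cl zs \<sqsubseteq>\<^bsub>L\<^esub> u"
      using assms(1-3) by (simp add: L_simps le_cl assms(4))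
  qed auto
qed

lemma L_greatest:
  assumes "adm xs" "adm ys" "adm zs" "\<And>x. cnt zs x = min (cnt xs x) (cnt ys x)"
  shows "greatest L (cl zs) (Lower L {cl xs, cl ys})"
proof -
  have Lower: "Lower L {cl xs, cl ys} = {u \<in> carrier L. u \<sqsubseteq>\<^bsub>L\<^esub> cl xs \<and> u \<sqsubseteq>\<^bsub>L\<^esub> cl ys}"
    using assms(1,2) by (auto simp: Lower_def L_simps admissible_cl)
  show ?thesis
    unfolding greatest_def Lower
  proof (intro conjI ballI)
    show "cl zs \<in> {u \<in> carrier L. u \<sqsubseteq>\<^bsub>L\<^esub> cl xs \<and> u \<sqsubseteq>\<^bsub>L\<^esub> cl ys}"
      using assms(1-3) by (simp add: L_simps admissible_cl le_cl assms(4))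
    fix u assume "u \<in> {u \<in> carrier L. u \<sqsubseteq>\<^bsub>L\<^esub> cl xs \<and> u \<sqsubseteq>\<^bsub>L\<^esub> cl ys}"
    then obtain us where "u = cl us" "adm us" "cl us \<sqsubseteq>\<^bsub>L\<^esub> cl xs" "cl us \<sqsubseteq>\<^bsub>L\<^esub> cl ys"
      by (auto simp: L_simps admissible_cl)
    then show "u \<sqsubseteq>\<^bsub>L\<^esub> cl zs"
      using assms(1-3) by (simp add: L_simps le_cl assms(4))
  qed auto
qed

lemma L_lattice: "lattice L"
proof -
  interpret partial_order L by (rule L_partial_order)
  show ?thesis
  proof
    fix X Y assume "X \<in> carrier L" "Y \<in> carrier L"
    then obtain xs ys where xs: "X = cl xs" "adm xs" and ys: "Y = cl ys" "adm ys"
      by (auto simp: L_simps admissible_cl)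
    show "\<exists>s. least L s (Upper L {X, Y})"
      using adm_join[OF xs(2) ys(2)] L_least[OF xs(2) ys(2)] xs ys by blast
    show "\<exists>s. greatest L s (Lower L {X, Y})"
      using adm_meet[OF xs(2) ys(2)] L_greatest[OF xs(2) ys(2)] xs ys by blast
  qed
qed

text \<open>The join is a chosen least upper bound; uniqueness of least elements identifies it with
  the class found in \<open>L_least\<close>.\<close>

lemma L_join:
  assumes "adm xs" "adm ys"
  obtains zs where "adm zs" "\<And>x. cnt zs x = max (cnt xs x) (cnt ys x)" "cl xs \<squnion>\<^bsub>L\<^esub> cl ys = cl zs"
proof -
  interpret lattice L by (rule L_lattice)
  obtain zs where zs: "adm zs" "\<And>x. cnt zs x = max (cnt xs x) (cnt ys x)"
    using adm_join[OF assms] by blast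
  have "cl xs \<squnion>\<^bsub>L\<^esub> cl ys = cl zs"
    unfolding join_def sup_def
    by (rule some_equality) (use L_least[OF assms zs] least_unique in auto)
  with zs that show ?thesis by blast
qed

lemma L_meet:
  assumes "adm xs" "adm ys"
  obtains zs where "adm zs" "\<And>x. cnt zs x = min (cnt xs x) (cnt ys x)" "cl xs \<sqinter>\<^bsub>L\<^esub> cl ys = cl zs"
proof -
  interpret lattice L by (rule L_lattice)
  obtain zs where zs: "adm zs" "\<And>x. cnt zs x = min (cnt xs x) (cnt ys x)"
    using adm_meet[OF assms] by blast
  have "cl xs \<sqinter>\<^bsub>L\<^esub> cl ys = cl zs"
    unfolding meet_def inf_def
    by (rule some_equality) (use L_greatest[OF assms zs] greatest_unique in auto)
  with zs that show ?thesis by blast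
qed

subsection \<open>Negation\<close>

lemma map_label: "xs \<in> lists V \<Longrightarrow> map l xs \<in> lists S"
  by (induction xs) auto

lemma wprod_gc:
  assumes "gc u v"
  shows "wprod (map l u) = wprod (map l v)"
  using assms
proof (induction rule: word_congr.induct)
  case (base u v)
  from base(1) show ?case
  proof cases
    case (1 x y)
    have xy: "l x \<in> S" "l y \<in> S" "l x \<noteq> l y" using 1 label_eq_iff by auto
    then have "cmatrix D (l x) (l y) = enat 2"
      using cmatrix_ge_2[OF xy] 1 by (auto simp: coxeter_edge_def numeral_eq_enat)
    from wprod_braid[OF xy(1,2) this] show ?thesis
      using 1 by (simp add: numeral_2_eq_2)
  qed
next
  case (append u v u' v')
  note V = append.hyps[THEN word_congr_lists(1)] append.hyps[THEN word_congr_lists(2)]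
  show ?case using V append.IH by (simp add: wprod_append map_label)
qed auto

lemma graph_monoid_hom_cl:
  assumes "xs \<in> lists V"
  shows "graph_monoid_hom D (cl xs) = wprod (map l xs)"
proof -
  have "(\<lambda>xs. wprod (map l xs)) ` cl xs = {wprod (map l xs)}"
    using gc_in_cl[OF assms] by (auto simp: cl_def dest: wprod_gc)
  then show ?thesis by (simp add: graph_monoid_hom_def)
qed

lemma vact_gc:
  assumes "gc u v"
  shows "vact u f = vact v f"
  by (rule act_cong[OF map_label map_label wprod_gc[OF assms]]) (use word_congr_lists[OF assms] in auto)

lemma cl_negators_iff:
  assumes "xs \<in> lists V"
  shows "cl xs \<in> negators D a \<longleftrightarrow> a \<in> roots D \<and> nonneg a \<and> nonpos (vact xs a)"
proof -
  have "coxeter_action D (graph_monoid_hom D (cl xs)) a = vact xs a"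
    using assms by (simp only: graph_monoid_hom_cl coxeter_action_wprod map_label)
  moreover have "cl xs \<in> carrier (graph_monoid D)" using assms by (auto simp: carrier_graph_monoid)
  ultimately show ?thesis
    using act_in_roots[OF _ map_label[OF assms], of a]
    unfolding negators_def positive_roots_def negative_roots_def nonneg_def nonpos_def mem_Collect_eq
    by metis
qed

text \<open>The letters of \<open>ys\<close> beyond those of \<open>xs\<close> can be moved to the left end, where they do not
  involve \<open>x\<close>.\<close>

lemma vact_coordinate:
  assumes "adm xs" "adm ys" "\<And>z. cnt xs z \<le> cnt ys z" "cnt xs x = cnt ys x" "x \<in> V"
  shows "vact ys f (l x) = vact xs f (l x)"
proof -
  obtain zs where zs: "adm (zs @ xs)" "\<And>z. cnt (zs @ xs) z = cnt ys z"
    using adm_extend[OF assms(2,1,3)] by blast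
  then have "vact ys f = vact (zs @ xs) f"
    using adm_same_cnt[OF assms(2) zs(1)] by (intro vact_gc) simp
  moreover have "x \<notin> set zs" using zs(2)[of x] assms(4) by (simp add: count_list_0_iff)
  then have "l x \<notin> l ` set zs"
    using zs(1)[THEN adm_verts] assms(5) label_eq_iff by auto
  ultimately show ?thesis by (simp add: act_outside)
qed

lemma nonposI: "(\<And>x. x \<in> V \<Longrightarrow> f (l x) \<le> 0) \<Longrightarrow> nonpos f"
  using bij_betw_imp_surj_on[OF bij_clabel] unfolding nonpos_def by (metis imageE)

lemma nonposD: "nonpos f \<Longrightarrow> x \<in> V \<Longrightarrow> f (l x) \<le> 0"
  by (simp add: nonpos_def)

lemma negators_join_meet:
  assumes "X \<in> negators D a \<inter> admissible D c" "Y \<in> negators D a \<inter> admissible D c"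
  shows "X \<squnion>\<^bsub>L\<^esub> Y \<in> negators D a \<inter> admissible D c"
    and "X \<sqinter>\<^bsub>L\<^esub> Y \<in> negators D a \<inter> admissible D c"
proof -
  obtain xs ys where X: "X = cl xs" "adm xs" and Y: "Y = cl ys" "adm ys"
    using assms by (auto simp: admissible_cl)
  then have neg: "a \<in> roots D" "nonneg a" "nonpos (vact xs a)" "nonpos (vact ys a)"
    using assms cl_negators_iff[of xs a] cl_negators_iff[of ys a] adm_verts by blast+
  show "X \<squnion>\<^bsub>L\<^esub> Y \<in> negators D a \<inter> admissible D c"
  proof (rule L_join[OF X(2) Y(2)])
    fix zs assume zs: "adm zs" "\<And>x. cnt zs x = max (cnt xs x) (cnt ys x)" "cl xs \<squnion>\<^bsub>L\<^esub> cl ys = cl zs"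
    have "nonpos (vact zs a)"
    proof (rule nonposI)
      fix x assume x: "x \<in> V"
      \<comment> \<open>The join agrees at \<open>x\<close> with whichever word contains
        \<open>x\<close> more often.\<close>
      have "vact zs a (l x) = vact xs a (l x) \<or> vact zs a (l x) = vact ys a (l x)"
      proof (cases "cnt xs x \<le> cnt ys x")
        case True
        then show ?thesis
          by (intro disjI2 vact_coordinate[OF Y(2) zs(1) _ _ x]) (simp_all add: zs(2))
      next
        case False
        then show ?thesis
          by (intro disjI1 vact_coordinate[OF X(2) zs(1) _ _ x]) (simp_all add: zs(2))
      qed
      then show "vact zs a (l x) \<le> 0" using nonposD[OF neg(3) x] nonposD[OF neg(4) x] by auto
    qed
    then have "cl zs \<in> negators D a"
      using neg(1,2) cl_negators_iff[OF adm_verts[OF zs(1)]] by blast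
    then show ?thesis unfolding X(1) Y(1) zs(3) admissible_cl using zs(1) by blast
  qed
  show "X \<sqinter>\<^bsub>L\<^esub> Y \<in> negators D a \<inter> admissible D c"
  proof (rule L_meet[OF X(2) Y(2)])
    fix zs assume zs: "adm zs" "\<And>x. cnt zs x = min (cnt xs x) (cnt ys x)" "cl xs \<sqinter>\<^bsub>L\<^esub> cl ys = cl zs"
    have "nonpos (vact zs a)"
    proof (rule nonposI)
      fix x assume x: "x \<in> V"
      \<comment> \<open>The meet agrees at \<open>x\<close> with whichever word contains
        \<open>x\<close> less often.\<close>
      have "vact zs a (l x) = vact xs a (l x) \<or> vact zs a (l x) = vact ys a (l x)"
      proof (cases "cnt xs x \<le> cnt ys x")
        case True
        then show ?thesis
          by (intro disjI1 vact_coordinate[OF zs(1) X(2) _ _ x, symmetric]) (simp_all add: zs(2))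
      next
        case False
        then show ?thesis
          by (intro disjI2 vact_coordinate[OF zs(1) Y(2) _ _ x, symmetric]) (simp_all add: zs(2))
      qed
      then show "vact zs a (l x) \<le> 0" using nonposD[OF neg(3) x] nonposD[OF neg(4) x] by auto
    qed
    then have "cl zs \<in> negators D a"
      using neg(1,2) cl_negators_iff[OF adm_verts[OF zs(1)]] by blast
    then show ?thesis unfolding X(1) Y(1) zs(3) admissible_cl using zs(1) by blast
  qed
qed

text \<open>Over the empty set the intersection on the right would be the whole type.\<close>

lemma set_negators_Inter:
  "\<Psi> \<noteq> {} \<Longrightarrow> set_negators D \<Psi> \<inter> admissible D c = (\<Inter>a\<in>\<Psi>. negators D a \<inter> admissible D c)"
  by (auto simp: set_negators_def admissible_def)

subsection \<open>The Euler form of an orientation\<close>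

text \<open>Matrix of the Euler form. For an orientation of the Coxeter graph, adding its transpose
  gives the matrix of \<open>B\<close>.\<close>

definition ecoef :: "('v \<times> 'v) set \<Rightarrow> 'v \<Rightarrow> 'v \<Rightarrow> real" where
  "ecoef R x y = (if x = y then 1 else 0) + (if (x, y) \<in> R then b (l x) (l y) else 0)"

definition euler :: "('v \<times> 'v) set \<Rightarrow> ('w \<Rightarrow> real) \<Rightarrow> ('w \<Rightarrow> real) \<Rightarrow> real" where
  "euler R f g = (\<Sum>x\<in>V. \<Sum>y\<in>V. f (l x) * g (l y) * ecoef R x y)"

lemma b_not_edge:
  assumes "x \<in> V" "y \<in> V" "x \<noteq> y" "\<not> E x y"
  shows "b (l x) (l y) = 0"
proof -
  have "l x \<noteq> l y" using assms label_eq_iff by simp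
  then have "cmatrix D (l x) (l y) = enat 2"
    using cmatrix_ge_2[of "l x" "l y"] assms by (auto simp: coxeter_edge_def numeral_eq_enat)
  then show ?thesis by (simp add: b_def coxeter_angle_def)
qed

lemma b_edge_neg:
  assumes "E x y"
  shows "b (l x) (l y) < 0"
proof (cases "cmatrix D (l x) (l y)")
  case (enat m)
  then have "2 < m" using assms by (simp add: coxeter_edge_def numeral_eq_enat)
  then have "0 < cos (pi / real m)" by (intro cos_gt_zero) (auto simp: field_simps)
  with enat show ?thesis by (simp add: b_def coxeter_angle_def)
next
  case infinity
  then show ?thesis by (simp add: b_def coxeter_angle_def)
qed

lemma form_simple_verts: "x \<in> V \<Longrightarrow> B (e (l x)) f = (\<Sum>y\<in>V. f (l y) * b (l x) (l y))"
  using sum.reindex_bij_betw[OF bij_clabel, of "\<lambda>t. f t * b (l x) t"] by (simp add: form_simple_left)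

lemma e_label: "x \<in> V \<Longrightarrow> y \<in> V \<Longrightarrow> e (l x) (l y) = (if y = x then 1 else 0)"
  using label_eq_iff by (auto simp: simple_root_def)

lemma euler_comb_left: "euler R (comb p f q h) g = p * euler R f g + q * euler R h g"
  by (simp add: euler_def comb_def algebra_simps sum.distrib sum_distrib_left)

lemma euler_comb_right: "euler R g (comb p f q h) = p * euler R g f + q * euler R g h"
  by (simp add: euler_def comb_def algebra_simps sum.distrib sum_distrib_left)

lemma euler_simple_left:
  assumes "x \<in> V"
  shows "euler R (e (l x)) g = (\<Sum>y\<in>V. g (l y) * ecoef R x y)"
proof -
  have "euler R (e (l x)) g = (\<Sum>z\<in>V. if z = x then \<Sum>y\<in>V. g (l y) * ecoef R x y else 0)"
    unfolding euler_def using assms by (intro sum.cong) (auto simp: e_label)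
  then show ?thesis using assms finite_verts by simp
qed

lemma euler_simple_right:
  assumes "x \<in> V"
  shows "euler R f (e (l x)) = (\<Sum>z\<in>V. f (l z) * ecoef R z x)"
proof -
  have "(\<Sum>y\<in>V. f (l z) * e (l x) (l y) * ecoef R z y) = f (l z) * ecoef R z x" for z
  proof -
    have "(\<Sum>y\<in>V. f (l z) * e (l x) (l y) * ecoef R z y) =
        (\<Sum>y\<in>V. if y = x then f (l z) * ecoef R z x else 0)"
      using assms by (intro sum.cong) (auto simp: e_label)
    then show ?thesis using assms finite_verts by simp
  qed
  then show ?thesis by (simp add: euler_def)
qed

lemma euler_simple: "x \<in> V \<Longrightarrow> y \<in> V \<Longrightarrow> euler R (e (l x)) (e (l y)) = ecoef R x y"
  using finite_verts
  by (simp add: euler_simple_left e_label if_distrib[of "\<lambda>z. z * _"] cong: if_cong)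

text \<open>The row of a sink has only its diagonal entry. This is how the form yields
  coordinates.\<close>

lemma euler_sink:
  assumes "is_sink D R x"
  shows "euler R (e (l x)) g = g (l x)"
proof -
  have x: "x \<in> V" "\<And>y. (x, y) \<notin> R" using assms by (auto simp: is_sink_def)
  then have "ecoef R x y = (if y = x then 1 else 0)" for y by (simp add: ecoef_def)
  then have "(\<Sum>y\<in>V. g (l y) * ecoef R x y) = (\<Sum>y\<in>V. if y = x then g (l x) else 0)"
    by (intro sum.cong) auto
  then show ?thesis using x finite_verts by (simp add: euler_simple_left)
qed

text \<open>Reversal at a sink moves the entries of its column into its row. The corrections may
  range over all vertices: they vanish at non-neighbours and cancel at the diagonal.\<close>

lemma ecoef_reverse:
  assumes "is_sink D (Q xs) x" "u \<in> V" "v \<in> V"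
  shows "ecoef (reverse_at x (Q xs)) u v =
    ecoef (Q xs) u v + (if u = x then b (l x) (l v) else 0) - (if v = x then b (l x) (l u) else 0)"
proof -
  have x: "x \<in> V" "\<And>y. (x, y) \<notin> Q xs" using assms by (auto simp: is_sink_def)
  have to_x: "(y, x) \<in> Q xs \<longleftrightarrow> E x y" for y
  proof (cases "E x y")
    case True
    then have "E y x" using E_sym by blast
    with True show ?thesis
      using x(2)[of y] Q_iff[of x y xs] Q_iff[of y x xs] Q0_total[of x y] by (simp add: add.commute) blast
  next
    case False
    then show ?thesis using Q_iff[of y x xs] E_sym[of x y] by simp
  qed
  have loop: "\<not> E x x" using E_verts by blast
  consider "u = x" "v = x" | "u = x" "v \<noteq> x" | "u \<noteq> x" "v = x" | "u \<noteq> x" "v \<noteq> x" by blast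
  then show ?thesis
  proof cases
    case 1
    then show ?thesis using x loop by (simp add: ecoef_def reverse_at_def)
  next
    case 2
    then show ?thesis
      using x to_x[of v] b_not_edge[of x v] assms by (auto simp: ecoef_def reverse_at_def)
  next
    case 3
    then show ?thesis
      using x to_x[of u] b_not_edge[of x u] assms b_sym[of "l u" "l x"]
      by (auto simp: ecoef_def reverse_at_def)
  next
    case 4
    then show ?thesis by (simp add: ecoef_def reverse_at_def)
  qed
qed

lemma euler_reverse:
  assumes sink: "is_sink D (Q xs) x"
  shows "euler (reverse_at x (Q xs)) f g =
    euler (Q xs) f g + f (l x) * B (e (l x)) g - g (l x) * B (e (l x)) f"
proof -
  have x: "x \<in> V" using sink by (simp add: is_sink_def)
  have "euler (reverse_at x (Q xs)) f g = (\<Sum>u\<in>V. \<Sum>v\<in>V. f (l u) * g (l v) * ecoef (Q xs) u v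
      + (if u = x then f (l x) * (g (l v) * b (l x) (l v)) else 0)
      - (if v = x then g (l x) * (f (l u) * b (l x) (l u)) else 0))"
    unfolding euler_def
    by (intro sum.cong HOL.refl) (auto simp: ecoef_reverse[OF sink] algebra_simps)
  also have "\<dots> = euler (Q xs) f g
      + (\<Sum>u\<in>V. if u = x then \<Sum>v\<in>V. f (l x) * (g (l v) * b (l x) (l v)) else 0)
      - (\<Sum>u\<in>V. \<Sum>v\<in>V. if v = x then g (l x) * (f (l u) * b (l x) (l u)) else 0)"
    unfolding sum_subtractf sum.distrib euler_def
    by (intro arg_cong2[of _ _ _ _ "(-)"] arg_cong2[of _ _ _ _ "(+)"] sum.cong HOL.refl) auto
  also have "\<dots> = euler (Q xs) f g + f (l x) * B (e (l x)) g - g (l x) * B (e (l x)) f"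
    using x finite_verts by (simp add: form_simple_verts flip: sum_distrib_left)
  finally show ?thesis .
qed

text \<open>After the reversal \<open>x\<close> is a source. Its row pairs with \<open>h\<close> to
  \<open>B (e (l x)) h - h (l x)\<close>, its column to the coordinate at \<open>x\<close>, and
  these values cancel the change recorded in \<open>euler_reverse\<close>.\<close>

lemma euler_refl:
  assumes sink: "is_sink D (Q xs) x"
  shows "euler (reverse_at x (Q xs)) (refl (l x) f) (refl (l x) g) = euler (Q xs) f g"
proof -
  let ?R = "reverse_at x (Q xs)"
  have x: "x \<in> V" using sink by (simp add: is_sink_def)
  have left: "euler ?R (e (l x)) h = B (e (l x)) h - h (l x)" for h
    using euler_reverse[OF sink, of "e (l x)" h] x
    by (simp add: euler_sink[OF sink] form_simple_simple)
  have col: "ecoef ?R u x = (if u = x then 1 else 0)" if "u \<in> V" for u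
    using sink by (simp add: ecoef_def reverse_at_def is_sink_def)
  have "euler ?R h (e (l x)) = (\<Sum>u\<in>V. if u = x then h (l x) else 0)" for h
    using x by (subst euler_simple_right) (auto intro!: sum.cong simp: col)
  then have right: "euler ?R h (e (l x)) = h (l x)" for h using x finite_verts by simp
  show ?thesis
    using x by (simp add: refl_comb_def euler_comb_left euler_comb_right left right
        euler_reverse[OF sink, of f g] form_simple_simple algebra_simps)
qed

lemma euler_vact:
  "adm (us @ xs) \<Longrightarrow> euler (Q (us @ xs)) (vact us f) (vact us g) = euler (Q xs) f g"
proof (induction us)
  case (Cons u us)
  then show ?case using euler_refl[of "us @ xs" u "vact us f" "vact us g"] by simp
qed simp

subsection \<open>Reduced admissible words\<close>

text \<open>\<open>vact (rev xs)\<close> is the inverse of \<open>vact xs\<close>, and prefixing a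
  letter lengthens the group element exactly when this inverse keeps the simple root of the letter
  positive.\<close>

fun red :: "'v list \<Rightarrow> bool" where
  "red [] \<longleftrightarrow> True"
| "red (x # xs) \<longleftrightarrow> red xs \<and> nonneg (vact (rev xs) (e (l x)))"

definition inverts_at :: "'v list \<Rightarrow> 'v \<Rightarrow> bool" where
  "inverts_at xs x \<longleftrightarrow>
    (\<forall>\<delta>\<in>roots D. nonneg \<delta> \<longrightarrow> 0 < \<delta> (l x) \<longrightarrow> nonpos (vact (rev xs) \<delta>))"

lemma vact_rev_vact: "xs \<in> lists V \<Longrightarrow> vact (rev xs) (vact xs f) = f"
  using act_rev_act[OF map_label, of xs f] by (simp add: rev_map)

lemma vact_vact_rev: "xs \<in> lists V \<Longrightarrow> vact xs (vact (rev xs) f) = f"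
  using act_act_rev[OF map_label, of xs f] by (simp add: rev_map)

lemma vact_in_roots: "f \<in> roots D \<Longrightarrow> xs \<in> lists V \<Longrightarrow> vact xs f \<in> roots D"
  using act_in_roots map_label by blast

lemma rev_lists: "xs \<in> lists V \<Longrightarrow> rev xs \<in> lists V"
  by (simp add: in_lists_conv_set)

text \<open>A negative root becomes positive under a simple reflection only if it is minus that
  simple root. Pulling this back along the word would make \<open>f\<close> negative, by
  reducedness.\<close>

lemma red_nonpos_append:
  assumes "red (us @ vs)" "us @ vs \<in> lists V" "f \<in> roots D" "nonneg f" "nonpos (vact vs f)"
  shows "nonpos (vact (us @ vs) f)"
  using assms(1,2)
proof (induction us)
  case Nil
  then show ?case using assms by simp
next
  case (Cons x us)
  define g where "g = vact (us @ vs) f"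
  have V: "us @ vs \<in> lists V" and x: "x \<in> V" using Cons.prems by auto
  have IH: "nonpos g" unfolding g_def using Cons by simp
  have g: "g \<in> roots D" unfolding g_def using assms(3) V by (rule vact_in_roots)
  show ?case
  proof (rule ccontr)
    assume "\<not> nonpos (vact ((x # us) @ vs) f)"
    then have "nonneg (refl (l x) g)"
      using root_sign[OF refl_in_roots[OF g, of "l x"]] x by (simp add: g_def)
    moreover have "refl (l x) (\<lambda>t. - g t) = (\<lambda>t. - refl (l x) g t)"
      using act_uminus[of "[l x]" g] by simp
    ultimately have "(\<lambda>t. - g t) = e (l x)"
      using refl_sign_change[OF roots_uminus[OF g], of "l x"] IH x by simp
    then have "g = (\<lambda>t. - e (l x) t)" by (metis minus_minus)
    then have "f = (\<lambda>t. - vact (rev (us @ vs)) (e (l x)) t)"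
      using vact_rev_vact[OF V, of f] act_uminus unfolding g_def[symmetric] by metis
    then have "nonpos f" using Cons.prems by simp
    then show False using root_not_both assms by blast
  qed
qed

text \<open>The sign must change at some letter, and by \<open>refl_sign_change\<close> the root
  just before is the simple root of that letter.\<close>

lemma sign_change_letter:
  assumes "xs \<in> lists V" "f \<in> roots D" "nonneg f" "nonpos (vact xs f)"
  shows "\<exists>us y vs. xs = us @ y # vs \<and> vact vs f = e (l y)"
  using assms(1,4)
proof (induction xs rule: list.induct)
  case Nil
  then show ?case using root_not_both assms by simp
next
  case (Cons x xs)
  have V: "xs \<in> lists V" "x \<in> V" using Cons.prems by auto
  have root: "vact xs f \<in> roots D" using assms(2) V(1) by (rule vact_in_roots)
  show ?case
  proof (cases "nonpos (vact xs f)")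
    case True
    then obtain us y vs where "xs = us @ y # vs" "vact vs f = e (l y)"
      using Cons.IH V by blast
    then show ?thesis by (intro exI[of _ "x # us"] exI[of _ y] exI[of _ vs]) simp
  next
    case False
    then have "nonneg (vact xs f)" using root_sign[OF root] by blast
    then have "vact xs f = e (l x)"
      using refl_sign_change[OF root, of "l x"] Cons.prems V by simp
    then show ?thesis by (intro exI[of _ "[]"] exI[of _ x] exI[of _ xs]) simp
  qed
qed

text \<open>If \<open>\<theta>\<close> is inverted, then \<open>- \<theta>\<close> comes from the simple root of a letter \<open>y\<close> of \<open>xs\<close>. Moving
  back to the time when \<open>y\<close> is a sink turns the Euler form into minus the \<open>y\<close>-coordinate of a
  positive root.\<close>

lemma euler_nonpos:
  assumes xs: "adm xs" "red xs"
    and \<theta>: "\<theta> \<in> roots D" "nonneg \<theta>" "nonpos (vact (rev xs) \<theta>)"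
    and \<delta>: "\<delta> \<in> roots D" "nonneg \<delta>" "nonneg (vact (rev xs) \<delta>)"
  shows "euler (Q xs) \<theta> \<delta> \<le> 0"
proof -
  have V: "xs \<in> lists V" and rV: "rev xs \<in> lists V" using adm_verts xs rev_lists by blast+
  define \<eta> where "\<eta> = (\<lambda>t. - vact (rev xs) \<theta> t)"
  define \<beta> where "\<beta> = vact (rev xs) \<delta>"
  have \<eta>: "\<eta> \<in> roots D" "nonneg \<eta>"
    unfolding \<eta>_def using vact_in_roots[OF \<theta>(1) rV] \<theta>(3) by (auto intro: roots_uminus)
  have x\<eta>: "vact xs \<eta> = (\<lambda>t. - \<theta> t)"
    unfolding \<eta>_def act_uminus vact_vact_rev[OF V] ..
  have \<beta>: "\<beta> \<in> roots D" "vact xs \<beta> = \<delta>"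
    unfolding \<beta>_def using vact_in_roots[OF \<delta>(1) rV] vact_vact_rev[OF V] by auto
  obtain us y vs where split: "xs = us @ y # vs" and y: "vact vs \<eta> = e (l y)"
    using sign_change_letter[OF V \<eta>] x\<eta> \<theta>(2) by auto
  have vs: "adm (y # vs)" using xs(1) split adm_append by blast
  then have sink: "is_sink D (Q vs) y" by simp
  have yV: "y \<in> V" "vs \<in> lists V" using V split by auto
  \<comment> \<open>Once negative, the root would stay negative along the reduced word
    \<open>xs\<close>, whose end value is the positive root \<open>\<delta>\<close>.\<close>
  have "nonneg (vact vs \<beta>)"
  proof (rule ccontr)
    assume "\<not> nonneg (vact vs \<beta>)"
    then have "nonpos (vact vs \<beta>)" using root_sign vact_in_roots[OF \<beta>(1) yV(2)] by blast
    then have "nonpos (vact ((us @ [y]) @ vs) \<beta>)"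
      using red_nonpos_append[of "us @ [y]" vs \<beta>] xs(2) V split \<beta>(1) \<delta>(3) by (simp add: \<beta>_def)
    then have "nonpos \<delta>" using \<beta>(2) split by simp
    then show False using root_not_both \<delta> by blast
  qed
  have "euler (Q xs) (vact xs \<eta>) (vact xs \<beta>) = euler (Q []) \<eta> \<beta>"
    using euler_vact[of xs "[]" \<eta> \<beta>] xs(1) by simp
  also have "\<dots> = euler (Q vs) (vact vs \<eta>) (vact vs \<beta>)"
    using euler_vact[of vs "[]" \<eta> \<beta>] vs by simp
  also have "\<dots> = vact vs \<beta> (l y)"
    unfolding y using euler_sink[OF sink] .
  finally have "euler (Q xs) (vact xs \<eta>) \<delta> = vact vs \<beta> (l y)" unfolding \<beta>(2) .
  moreover have "vact xs \<eta> = comb (- 1) \<theta> 0 \<theta>" unfolding x\<eta> by (simp add: comb_def)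
  ultimately have "- euler (Q xs) \<theta> \<delta> = vact vs \<beta> (l y)" by (simp add: euler_comb_left)
  moreover have "0 \<le> vact vs \<beta> (l y)" using \<open>nonneg (vact vs \<beta>)\<close> yV by (simp add: nonneg_def)
  ultimately show ?thesis by simp
qed

text \<open>Invariance carries the pairing forward along \<open>zs\<close> to the moment when
  \<open>s\<close> is a sink; no reflection on the way touches the coordinate at
  \<open>s\<close>.\<close>

lemma euler_next:
  assumes "adm (s # zs @ xs)" "s \<notin> set zs"
  shows "euler (Q xs) (vact (rev zs) (e (l s))) \<delta> = \<delta> (l s)"
proof -
  have adm: "adm (zs @ xs)" and sink: "is_sink D (Q (zs @ xs)) s" using assms by simp_all
  have V: "s \<in> V" "zs \<in> lists V" using adm_verts[OF assms(1)] by auto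
  have "euler (Q xs) (vact (rev zs) (e (l s))) \<delta> =
      euler (Q (zs @ xs)) (vact zs (vact (rev zs) (e (l s)))) (vact zs \<delta>)"
    using euler_vact[OF adm] by simp
  also have "\<dots> = vact zs \<delta> (l s)"
    unfolding vact_vact_rev[OF V(2)] using euler_sink[OF sink] .
  also have "l s \<notin> l ` set zs" using assms(2) V label_eq_iff by auto
  then have "vact zs \<delta> (l s) = \<delta> (l s)" by (intro act_outside) simp
  finally show ?thesis .
qed

text \<open>If \<open>\<delta>\<close> stayed positive, its pairing with the inverted root would be
  nonpositive by \<open>euler_nonpos\<close>, but \<open>euler_next\<close> evaluates it to the
  positive coordinate at \<open>s\<close>.\<close>

lemma inverts_at_next:
  assumes "adm xs" "red xs" "adm (s # zs @ xs)" "s \<notin> set zs"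
    and "nonneg (vact (rev zs) (e (l s)))" "nonpos (vact (rev xs) (vact (rev zs) (e (l s))))"
  shows "inverts_at xs s"
  unfolding inverts_at_def
proof (intro ballI impI)
  fix \<delta> assume \<delta>: "\<delta> \<in> roots D" "nonneg \<delta>" "0 < \<delta> (l s)"
  have V: "s \<in> V" "zs \<in> lists V" "xs \<in> lists V" using adm_verts[OF assms(3)] by auto
  have \<theta>: "vact (rev zs) (e (l s)) \<in> roots D"
    using V by (intro vact_in_roots simple_in_roots rev_lists) auto
  show "nonpos (vact (rev xs) \<delta>)"
  proof (rule ccontr)
    assume "\<not> nonpos (vact (rev xs) \<delta>)"
    then have "nonneg (vact (rev xs) \<delta>)"
      using root_sign vact_in_roots[OF \<delta>(1) rev_lists[OF V(3)]] by blast
    from euler_nonpos[OF assms(1,2) \<theta> assms(5,6) \<delta>(1,2) this]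
    show False using euler_next[OF assms(3,4)] \<delta>(3) by simp
  qed
qed

text \<open>Consider the first use of \<open>s\<close> after \<open>xs\<close>, and let
  \<open>\<theta>\<close> be its simple root pulled back to \<open>xs\<close>. If
  \<open>\<theta>\<close> has a letter used earlier in its support, the induction hypothesis inverts
  it; otherwise \<open>\<theta>\<close> is the simple root of \<open>s\<close>, which is already a
  sink and hence blocked.\<close>

lemma inverts_at_extension:
  assumes xs: "adm xs" "red xs"
    and blocked: "\<And>x. is_sink D (Q xs) x \<Longrightarrow> nonpos (vact (rev xs) (e (l x)))"
  shows "adm (us @ xs) \<Longrightarrow> s \<in> set us \<Longrightarrow> inverts_at xs s"
proof (induction us arbitrary: s)
  case (Cons z us)
  show ?case
  proof (cases "s \<in> set us")
    case True
    then show ?thesis using Cons by simp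
  next
    case False
    then have adm: "adm (s # us @ xs)" using Cons.prems by auto
    have V: "s \<in> V" "us \<in> lists V" using adm_verts[OF adm] by auto
    define \<theta> where "\<theta> = vact (rev us) (e (l s))"
    have \<theta>: "\<theta> \<in> roots D"
      unfolding \<theta>_def using V by (intro vact_in_roots simple_in_roots rev_lists) auto
    have out: "\<theta> t = e (l s) t" if "t \<notin> l ` set us" for t
      unfolding \<theta>_def using that by (intro act_outside) simp
    have "\<theta> (l s) = 1" using out[of "l s"] False V label_eq_iff by auto
    then have "\<not> nonpos \<theta>" using nonposD[of \<theta> s] V by auto
    then have nonneg: "nonneg \<theta>" using root_sign[OF \<theta>] by blast
    have "nonpos (vact (rev xs) \<theta>)"
    proof (cases "\<exists>y\<in>set us. 0 < \<theta> (l y)")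
      case True
      then show ?thesis
        using Cons.IH Cons.prems \<theta> nonneg by (auto simp: inverts_at_def)
    next
      case no: False
      have "\<theta> = e (l s)"
      proof (rule root_eq_simple[OF \<theta> nonneg])
        fix t assume t: "t \<in> S" "t \<noteq> l s"
        show "\<theta> t = 0"
        proof (cases "t \<in> l ` set us")
          case True
          then show ?thesis using no nonneg t by (force simp: nonneg_def)
        next
          case False
          then show ?thesis using out t by simp
        qed
      qed (use V in simp)
      \<comment> \<open>By \<open>euler_next\<close> the pairing of the simple roots of
        \<open>s\<close> and \<open>y\<close> is 0, whereas an arrow from \<open>s\<close> to
        \<open>y\<close> would make it the negative number \<open>b (l s) (l y)\<close>.\<close>
      have "is_sink D (Q xs) s"
        unfolding is_sink_def
      proof (intro conjI allI notI)
        fix y assume sy: "(s, y) \<in> Q xs"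
        then have "E s y" using Q_iff by blast
        then have y: "y \<in> V" "y \<noteq> s" using E_verts by blast+
        have "euler (Q xs) (e (l s)) (e (l y)) = 0"
          using euler_next[OF adm False, of "e (l y)"] \<open>\<theta> = e (l s)\<close> V y
          by (simp add: \<theta>_def e_label)
        moreover have "euler (Q xs) (e (l s)) (e (l y)) = b (l s) (l y)"
          using V y sy by (simp add: euler_simple ecoef_def)
        ultimately show False using b_edge_neg[OF \<open>E s y\<close>] by simp
      qed (use V in simp)
      then show ?thesis using blocked \<open>\<theta> = e (l s)\<close> by simp
    qed
    then show ?thesis
      using inverts_at_next[OF xs adm False] nonneg by (simp add: \<theta>_def)
  qed
qed simp

section \<open>Powers of the Coxeter element, extensions and length bounds\<close>

lemma cverts_word:
  obtains cv where "distinct cv" "set cv = V"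
    "\<And>u x w y. cv = u @ x # w \<Longrightarrow> y \<in> set w \<Longrightarrow> E x y \<Longrightarrow> (x, y) \<in> Q0"
proof
  define cv where "cv = map (inv_into V l) cword"
  have inj: "inj_on l V" and im: "l ` V = S" using bij_clabel by (auto simp: bij_betw_def)
  have l_cv: "map l cv = cword"
    unfolding cv_def map_map
    by (rule map_idI) (use cword im f_inv_into_f[of _ l V] in auto)
  show "distinct cv"
    using cword(1) distinct_map[of l cv] by (simp add: l_cv)
  have "set cv = inv_into V l ` l ` V" by (simp add: cv_def cword im)
  then show "set cv = V" using inj by (simp add: inv_into_image_cancel)
  fix u x w y assume cv: "cv = u @ x # w" "y \<in> set w" "E x y"
  obtain j where j: "j < length w" "w ! j = y" using cv(2) by (meson in_set_conv_nth)
  have "cword = map l u @ l x # map l w" using l_cv cv(1) by auto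
  then have "length u < length u + Suc j" "length u + Suc j < length cword"
    "cword ! length u = l x" "cword ! (length u + Suc j) = l y"
    using j by (auto simp: nth_append)
  then show "(x, y) \<in> Q0" unfolding Q0_iff using cv(3) by blast
qed

text \<open>The witness is the \<open>k\<close>-th power of a word for \<open>c\<close>.\<close>

lemma adm_power:
  "\<exists>xs. adm xs \<and> (\<forall>x\<in>V. cnt xs x = k)"
proof -
  obtain cv where cv: "distinct cv" "set cv = V"
    and orient: "\<And>u x w y. cv = u @ x # w \<Longrightarrow> y \<in> set w \<Longrightarrow> E x y \<Longrightarrow> (x, y) \<in> Q0"
    using cverts_word by blast
  have cnt1: "cnt w x = (if x \<in> set w then 1 else 0)" if "distinct w" for w x
    using that by (induction w) auto
  show ?thesis
  proof (induction k)
    case 0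
    then show ?case by (intro exI[of _ "[]"]) simp
  next
    case (Suc k)
    then obtain xs where xs: "adm xs" "\<And>x. x \<in> V \<Longrightarrow> cnt xs x = k" by blast
    \<comment> \<open>The next copy of \<open>cv\<close> is added suffix by suffix. The neighbours
      of \<open>x\<close> that already have \<open>Suc k\<close> occurrences are those in
      \<open>w\<close>, exactly the ones to which \<open>x\<close> has an arrow.\<close>
    have "adm (w @ xs)" if "cv = u @ w" for u w
      using that
    proof (induction w arbitrary: u)
      case (Cons x w)
      have "adm (w @ xs)" using Cons.IH[of "u @ [x]"] Cons.prems by simp
      moreover have "x \<in> V" using cv Cons.prems by auto
      moreover have "cnt (w @ xs) y = cnt (w @ xs) x + \<epsilon> x y" if "E x y" for y
      proof -
        have y: "y \<in> V" "y \<noteq> x" using E_verts[OF that] by auto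
        have dist: "distinct w" "x \<notin> set w" using cv Cons.prems by auto
        have "(x, y) \<in> Q0 \<longleftrightarrow> y \<in> set w"
        proof
          assume xy: "(x, y) \<in> Q0"
          show "y \<in> set w"
          proof (rule ccontr)
            assume "y \<notin> set w"
            then have "y \<in> set u" using y cv Cons.prems by auto
            then obtain u1 u2 where "u = u1 @ y # u2" by (meson split_list)
            then have "(y, x) \<in> Q0"
              using orient[of u1 y "u2 @ x # w" x] Cons.prems that E_sym by simp
            with xy show False using Q0_total[OF that] by blast
          qed
        qed (use orient[OF Cons.prems] that in blast)
        then show ?thesis
          using cnt1[OF dist(1)] dist(2) xs(2) y \<open>x \<in> V\<close> by (simp add: \<epsilon>_def)
      qed
      ultimately show ?case unfolding append_Cons adm_Cons by blast
    qed (use xs in simp)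
    then have "adm (cv @ xs)" by simp
    moreover have "\<forall>x\<in>V. cnt (cv @ xs) x = Suc k" using cnt1[OF cv(1)] cv xs by simp
    ultimately show ?case by blast
  qed
qed

text \<open>A power with exponent \<open>Suc (length xs)\<close> exceeds every multiplicity in
  \<open>xs\<close>, so each vertex must occur in the added part.\<close>

lemma adm_extend_full:
  assumes "adm xs"
  shows "\<exists>us. adm (us @ xs) \<and> V \<subseteq> set us"
proof -
  obtain ys where ys: "adm ys" "\<And>x. x \<in> V \<Longrightarrow> cnt ys x = Suc (length xs)"
    using adm_power by blast
  have le: "cnt xs x \<le> cnt ys x" for x
  proof (cases "x \<in> V")
    case True
    then show ?thesis using ys(2) count_le_length[of xs x] by simp
  next
    case False
    then have "x \<notin> set xs" using adm_verts[OF assms] by auto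
    then show ?thesis by (simp add: count_list_0_iff)
  qed
  then obtain us where us: "adm (us @ xs)" "\<And>x. cnt (us @ xs) x = cnt ys x"
    using adm_extend[OF ys(1) assms] by blast
  have "x \<in> set us" if "x \<in> V" for x
  proof (rule ccontr)
    assume "x \<notin> set us"
    then have "cnt xs x = Suc (length xs)"
      using us(2)[of x] ys(2)[OF that] by (simp add: count_list_0_iff)
    then show False using count_le_length[of xs x] by simp
  qed
  with us show ?thesis by blast
qed

text \<open>Multiplicities of neighbours differ by at most one, so along a path from
  \<open>x\<close> every multiplicity is bounded in terms of that of \<open>x\<close>.\<close>

lemma adm_length_bound:
  assumes "coxeter_irreducible D" "x \<in> V"
  shows "\<exists>N. \<forall>xs. adm xs \<longrightarrow> cnt xs x = M \<longrightarrow> length xs \<le> N"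
proof -
  have "\<exists>d. \<forall>xs. adm xs \<longrightarrow> cnt xs y \<le> cnt xs x + d" if "y \<in> V" for y
  proof -
    have "(x, y) \<in> {(u, v). E u v}\<^sup>*"
      using assms that by (simp add: coxeter_irreducible_def)
    then show ?thesis
    proof (induction rule: rtrancl_induct)
      case base
      then show ?case by (intro exI[of _ 0]) simp
    next
      case (step y z)
      then obtain d where d: "\<And>xs. adm xs \<Longrightarrow> cnt xs y \<le> cnt xs x + d" by blast
      have "cnt xs z \<le> cnt xs x + (d + 1)" if "adm xs" for xs
      proof -
        have "cnt xs z \<le> cnt xs y + \<epsilon> y z" using adm_bounds[OF that, of y z] step by simp
        moreover have "\<epsilon> y z \<le> 1" by (simp add: \<epsilon>_def)
        ultimately show ?thesis using d[OF that] by linarith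
      qed
      then show ?case by blast
    qed
  qed
  then obtain d where d: "\<And>y xs. y \<in> V \<Longrightarrow> adm xs \<Longrightarrow> cnt xs y \<le> cnt xs x + d y"
    by metis
  have "length xs \<le> (\<Sum>y\<in>V. M + d y)" if "adm xs" "cnt xs x = M" for xs
  proof -
    have "length xs = (\<Sum>y\<in>V. cnt xs y)"
      using adm_verts[OF that(1)] finite_verts by (intro sum_count_set[symmetric]) auto
    also have "\<dots> \<le> (\<Sum>y\<in>V. M + d y)" using d that by (intro sum_mono) auto
    finally show ?thesis .
  qed
  then show ?thesis by blast
qed

text \<open>\<open>ws\<close> is the longest reduced suffix and \<open>x\<close> the letter at which
  reducedness fails.\<close>

lemma not_red_cases:
  assumes "adm xs" "\<not> red xs"
  shows "\<exists>x ws. adm (x # ws) \<and> red ws \<and> nonpos (vact (rev ws) (e (l x)))"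
  using assms
proof (induction xs)
  case (Cons x xs)
  show ?case
  proof (cases "red xs")
    case True
    have V: "x \<in> V" "xs \<in> lists V" using adm_verts[OF Cons.prems(1)] by auto
    then have "vact (rev xs) (e (l x)) \<in> roots D"
      by (intro vact_in_roots simple_in_roots rev_lists) auto
    then have "nonpos (vact (rev xs) (e (l x)))"
      using root_sign Cons.prems(2) True by auto
    with True Cons.prems(1) show ?thesis by blast
  qed (use Cons in simp)
qed simp

text \<open>Once some sink \<open>x\<close> is blocked it stays blocked until \<open>x\<close> is used again. By connectedness a
  reduced word can be continued only finitely often without \<open>x\<close>, and then all sinks are blocked.\<close>

lemma adm_inverts_all:
  assumes irr: "coxeter_irreducible D" and nred: "adm xs" "\<not> red xs"
  shows "\<exists>ys. adm ys \<and> (\<forall>f\<in>roots D. nonneg f \<longrightarrow> nonpos (vact ys f))"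
proof -
  obtain x ws where xws: "adm (x # ws)" and ws: "red ws" "nonpos (vact (rev ws) (e (l x)))"
    using not_red_cases[OF nred] by blast
  have x: "x \<in> V" and adm_ws: "adm ws" using xws unfolding adm_Cons by auto
  \<comment> \<open>Keeping the multiplicity of \<open>x\<close> fixed means that only letters other
    than \<open>x\<close> are added, and it bounds the length.\<close>
  define P where "P ys \<longleftrightarrow> adm ys \<and> red ys \<and> cnt ys x = cnt ws x \<and> inverts_at ys x" for ys
  have "inverts_at ws x"
    using inverts_at_next[of ws x "[]"] xws adm_ws ws nonneg_simple by simp
  then have "P ws" using adm_ws ws by (simp add: P_def)
  obtain N where "\<And>ys. P ys \<Longrightarrow> length ys \<le> N"
    using adm_length_bound[OF irr x, of "cnt ws x"] unfolding P_def by blast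
  then obtain ys where P: "P ys" and max: "\<And>zs. P zs \<Longrightarrow> length zs \<le> length ys"
    using ex_has_greatest_nat[of P ws length "Suc N"] \<open>P ws\<close> by (auto simp: le_imp_less_Suc)
  have ys: "adm ys" "red ys" "cnt ys x = cnt ws x" "inverts_at ys x" using P by (auto simp: P_def)
  have blocked: "nonpos (vact (rev ys) (e (l z)))" if sink: "is_sink D (Q ys) z" for z
  proof (rule ccontr)
    assume np: "\<not> nonpos (vact (rev ys) (e (l z)))"
    have z: "z \<in> V" using sink by (simp add: is_sink_def)
    have "vact (rev ys) (e (l z)) \<in> roots D"
      using z adm_verts[OF ys(1)] by (intro vact_in_roots simple_in_roots rev_lists) auto
    then have nn: "nonneg (vact (rev ys) (e (l z)))" using root_sign np by blast
    have "z \<noteq> x"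
      using np ys(4) simple_in_roots[of "l x"] nonneg_simple x by (auto simp: inverts_at_def)
    \<comment> \<open>As \<open>z\<close> differs from \<open>x\<close>, the reflection keeps the
      coordinate at \<open>x\<close>, so the reflected root is positive and still has
      \<open>x\<close> in its support.\<close>
    have "inverts_at (z # ys) x"
      unfolding inverts_at_def
    proof (intro ballI impI)
      fix \<delta> assume \<delta>: "\<delta> \<in> roots D" "nonneg \<delta>" "0 < \<delta> (l x)"
      have root: "refl (l z) \<delta> \<in> roots D" using \<delta> z refl_in_roots by simp
      have pos: "0 < refl (l z) \<delta> (l x)"
        using \<delta> \<open>z \<noteq> x\<close> label_eq_iff[OF x z] by (simp add: refl_outside)
      then have "\<not> nonpos (refl (l z) \<delta>)" using x by (auto simp: nonpos_def not_le)
      then have "nonneg (refl (l z) \<delta>)" using root_sign[OF root] by blast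
      then have "nonpos (vact (rev ys) (refl (l z) \<delta>))"
        using ys(4) root pos by (simp add: inverts_at_def)
      then show "nonpos (vact (rev (z # ys)) \<delta>)" by simp
    qed
    then have "P (z # ys)" using ys sink nn \<open>z \<noteq> x\<close> by (simp add: P_def)
    from max[OF this] show False by simp
  qed
  \<comment> \<open>An extension that uses every vertex lets \<open>inverts_at_extension\<close>
    speak about all of them.\<close>
  obtain us where us: "adm (us @ ys)" "V \<subseteq> set us" using adm_extend_full[OF ys(1)] by blast
  have inv: "inverts_at ys s" if "s \<in> V" for s
    using inverts_at_extension[OF ys(1,2) blocked us(1)] us(2) that by blast
  have V: "ys \<in> lists V" using adm_verts[OF ys(1)] .
  have "nonpos (vact ys f)" if f: "f \<in> roots D" "nonneg f" for f
  proof (rule ccontr)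
    assume np: "\<not> nonpos (vact ys f)"
    have root: "vact ys f \<in> roots D" using f(1) V by (rule vact_in_roots)
    then have nn: "nonneg (vact ys f)" using root_sign np by blast
    obtain s where "s \<in> V" "0 < vact ys f (l s)" using np nonposI[of "vact ys f"] by force
    then have "nonpos (vact (rev ys) (vact ys f))"
      using inv root nn by (simp add: inverts_at_def)
    then have "nonpos f" by (simp only: vact_rev_vact[OF V])
    then show False using root_not_both f by blast
  qed
  with ys(1) show ?thesis by blast
qed

section \<open>Simultaneous negation and the sublattice property\<close>

lemma adm_negates_finite:
  assumes irr: "coxeter_irreducible D" and fin: "finite F"
    and F: "\<And>a. a \<in> F \<Longrightarrow> a \<in> roots D \<and> nonneg a \<and> (\<exists>xs. adm xs \<and> nonpos (vact xs a))"
  shows "\<exists>xs. adm xs \<and> (\<forall>a\<in>F. nonpos (vact xs a))"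
proof (cases "\<forall>xs. adm xs \<longrightarrow> red xs")
  case False
  then obtain xs where "adm xs" "\<not> red xs" by blast
  from adm_inverts_all[OF irr this] F show ?thesis by blast
next
  case all_red: True
  \<comment> \<open>A larger admissible element is represented by a left extension of
    \<open>xs\<close>, which is reduced by assumption, so \<open>red_nonpos_append\<close>
    applies.\<close>
  have mono: "nonpos (vact zs a)"
    if a: "a \<in> roots D" "nonneg a" and xs: "adm xs" "nonpos (vact xs a)"
      and zs: "adm zs" "\<And>x. cnt xs x \<le> cnt zs x" for a xs zs
  proof -
    obtain us where us: "adm (us @ xs)" "\<And>x. cnt (us @ xs) x = cnt zs x"
      using adm_extend[OF zs(1) xs(1) zs(2)] by blast
    have "gc zs (us @ xs)" using adm_same_cnt[OF zs(1) us(1)] us(2) by simp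
    then have "vact zs a = vact (us @ xs) a" by (rule vact_gc)
    then show ?thesis
      using red_nonpos_append[OF _ adm_verts[OF us(1)] a xs(2)] us(1) all_red by simp
  qed
  show ?thesis
    using fin F
  proof (induction F)
    case empty
    then show ?case by (intro exI[of _ "[]"]) simp
  next
    case (insert a F)
    then obtain xs where xs: "adm xs" "\<And>a. a \<in> F \<Longrightarrow> nonpos (vact xs a)" by blast
    have a: "a \<in> roots D" "nonneg a" using insert.prems[of a] by auto
    obtain ys where ys: "adm ys" "nonpos (vact ys a)" using insert.prems[of a] by auto
    obtain us where us: "adm (us @ xs)" "\<And>x. cnt (us @ xs) x = max (cnt xs x) (cnt ys x)"
      using adm_join[OF xs(1) ys(1)] by blast
    have "nonpos (vact (us @ xs) a)"
      using mono[OF a ys us(1)] by (simp only: us(2) max.cobounded2)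
    moreover have "nonpos (vact (us @ xs) f)" if "f \<in> F" for f
      using mono[of f xs "us @ xs"] insert.prems[of f] that xs us(1) by (simp only: us(2) max.cobounded1) blast
    ultimately show ?case using us(1) by (intro exI[of _ "us @ xs"]) blast
  qed
qed

lemma preprojective_iff:
  "a \<in> preprojective_roots D c \<longleftrightarrow>
    a \<in> roots D \<and> nonneg a \<and> (\<exists>xs. adm xs \<and> nonpos (vact xs a))"
proof -
  have "(\<exists>X\<in>admissible D c. X \<in> negators D a) \<longleftrightarrow>
      a \<in> roots D \<and> nonneg a \<and> (\<exists>xs. adm xs \<and> nonpos (vact xs a))"
    unfolding admissible_cl using cl_negators_iff[of _ a] adm_verts by blast
  then show ?thesis
    by (auto simp: preprojective_roots_def positive_roots_def nonneg_def)
qed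

lemma set_negators_nonempty:
  assumes "coxeter_irreducible D" "finite \<Psi>" "\<Psi> \<subseteq> preprojective_roots D c"
  shows "set_negators D \<Psi> \<inter> admissible D c \<noteq> {}"
proof -
  have \<Psi>: "\<And>a. a \<in> \<Psi> \<Longrightarrow> a \<in> roots D \<and> nonneg a \<and> (\<exists>xs. adm xs \<and> nonpos (vact xs a))"
    using assms(3) preprojective_iff by blast
  obtain xs where xs: "adm xs" "\<And>a. a \<in> \<Psi> \<Longrightarrow> nonpos (vact xs a)"
    using adm_negates_finite[OF assms(1,2) \<Psi>] by blast
  have "cl xs \<in> negators D a" if "a \<in> \<Psi>" for a
    using cl_negators_iff[OF adm_verts[OF xs(1)]] xs(2) \<Psi> that by blast
  then have "cl xs \<in> set_negators D \<Psi> \<inter> admissible D c"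
    using xs(1) adm_verts[OF xs(1)] by (auto simp: set_negators_def admissible_cl carrier_graph_monoid)
  then show ?thesis by blast
qed

lemma set_negators_sublattice:
  assumes "coxeter_irreducible D" "finite \<Psi>" "\<Psi> \<noteq> {}" "\<Psi> \<subseteq> preprojective_roots D c"
  shows "sublattice L (set_negators D \<Psi> \<inter> admissible D c)"
  unfolding sublattice_def
proof (intro conjI ballI)
  show "lattice L" by (rule L_lattice)
  show "set_negators D \<Psi> \<inter> admissible D c \<noteq> {}"
    using assms by (intro set_negators_nonempty)
  show "set_negators D \<Psi> \<inter> admissible D c \<subseteq> carrier L" by (simp add: L_simps)
  fix X Y assume "X \<in> set_negators D \<Psi> \<inter> admissible D c" "Y \<in> set_negators D \<Psi> \<inter> admissible D c"
  then have XY: "X \<in> negators D a \<inter> admissible D c" "Y \<in> negators D a \<inter> admissible D c"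
    if "a \<in> \<Psi>" for a
    using that by (auto simp: set_negators_def)
  show "X \<squnion>\<^bsub>L\<^esub> Y \<in> set_negators D \<Psi> \<inter> admissible D c"
    unfolding set_negators_Inter[OF assms(3)] using negators_join_meet(1)[OF XY] by (rule INT_I)
  show "X \<sqinter>\<^bsub>L\<^esub> Y \<in> set_negators D \<Psi> \<inter> admissible D c"
    unfolding set_negators_Inter[OF assms(3)] using negators_join_meet(2)[OF XY] by (rule INT_I)
qed

end

theorem theorem2p3:
  fixes D :: "('w, 'v) coxeter_data"
    and c :: 'w
    and \<alpha> :: "'w \<Rightarrow> real"
    and \<Psi> :: "('w \<Rightarrow> real) set"
  assumes "coxeter_system D"
    and "finite (cgens D)"
    and "coxeter_irreducible D"
    and "coxeter_element D c"
    and "\<alpha> \<in> preprojective_roots D c"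
    and "\<Psi> \<subseteq> preprojective_roots D c"
    and "finite \<Psi>"
    and "\<Psi> \<noteq> {}"
  shows "sublattice (admissible_order D c) (negators D \<alpha> \<inter> admissible D c) \<and>
         sublattice (admissible_order D c) (set_negators D \<Psi> \<inter> admissible D c)"
proof -
  interpret coxeter_elt D c
    using assms by unfold_locales
  \<comment> \<open>The statement for one root is the case of a singleton.\<close>
  have "sublattice (admissible_order D c) (set_negators D {\<alpha>} \<inter> admissible D c)"
    using assms by (intro set_negators_sublattice) auto
  moreover have "set_negators D {\<alpha>} \<inter> admissible D c = negators D \<alpha> \<inter> admissible D c"
    using set_negators_Inter[of "{\<alpha>}"] by simp
  ultimately show ?thesis
    using set_negators_sublattice[of \<Psi>] assms by simp
qed

end
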